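(* Let $G$ be a finite abelian group and $V$ a (not necessarily faithful) finite dimensional $\mathbb{C}G$-module with $\dim V\ge3$, and let $K=\{g\in G:V^g=V\}$ be the kernel of the action of $G$ on $V$. Then: (1) there is a Hochschild 2-cocycle (element of $\mathrm{HH}^2(S(V)\#G)$) supported on $K$ whose square bracket is nonzero, i.e. $\alpha$ with $[\alpha,\alpha]\neq0$ in $\mathrm{HH}^3(S(V)\#G)$; (2) there is a Hochschild 2-cocycle (element of $\mathrm{HH}^2(S(V)\#G)$) supported on $K$ whose square bracket is zero.
   Context: $V^g=\{v\in V:{}^gv=v\}$. $S(V)$ is the symmetric algebra of $V$ with the induced $G$-action. The skew group algebra $A=S(V)\#G$ is $S(V)\otimes\mathbb{C}G$ (write $s\overline g$ for $s\otimes g$) with $(r\overline g)(s\overline h)=r({}^gs)\overline{gh}$. $\mathrm{HH}^\bullet(A,M)=\mathrm{Ext}^\bullet_{A\otimes A^{op}}(A,M)$, $\mathrm{HH}^\bullet(A)=\mathrm{HH}^\bullet(A,A)$, computed by bar cochains $\mathrm{Hom}_{\mathbb C}(A^{\otimes p},M)$. Gerstenhaber bracket: for $f,f'$ of degrees $p,q$, $[f,f']=f\,\overline\circ\, f'-(-1)^{(p-1)(q-1)}f'\,\overline\circ\, f$, where $(f\,\overline\circ\, f')(a_1\otimes\cdots\otimes a_{p+q-1})=\sum_{k=1}^p(-1)^{(q-1)(k-1)}f(a_1\otimes\cdots\otimes a_{k-1}\otimes f'(a_k\otimes\cdots\otimes a_{k+q-1})\otimes a_{k+q}\otimes\cdots\otimes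 a_{p+q-1})$; the square bracket of $\alpha$ is $[\alpha,\alpha]$. Support: restricting cochains along $S(V)\hookrightarrow A$ induces an isomorphism $\mathrm{HH}^\bullet(A)\cong\mathrm{HH}^\bullet(S(V),A)^G$, and $\mathrm{HH}^\bullet(S(V),A)=\bigoplus_{g\in G}\mathrm{HH}^\bullet(S(V),S(V)\overline g)$ since $A=\bigoplus_gS(V)\overline g$ as $S(V)$-bimodules. An element of $\mathrm{HH}^\bullet(A)$ is supported on $X\subseteq G$ if its image lies in $\bigoplus_{g\in X}\mathrm{HH}^\bullet(S(V),S(V)\overline g)$. *)

theory Defs
  imports
    Complex_Main
    "HOL-Algebra.Group_Action"
    "HOL-Algebra.Module"
    "HOL-Algebra.QuotRing"
    "HOL-Library.Poly_Mapping"
begin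

section \<open>The symmetric algebra of a complex vector space\<close>

text \<open>
  $S(V)$ is the polynomial ring with one variable for each vector of $V$, modulo the ideal that
  makes the map sending a vector to its variable linear. A monomial is a finitely supported
  exponent function \<open>'v \<Rightarrow>\<^sub>0 nat\<close>.
\<close>

type_synonym 'v vpoly = "('v \<Rightarrow>\<^sub>0 nat) \<Rightarrow>\<^sub>0 complex"

definition vpoly_const :: "complex \<Rightarrow> 'v vpoly" where
  "vpoly_const c = Poly_Mapping.single 0 c"

definition vpoly_var :: "'v \<Rightarrow> 'v vpoly" where
  "vpoly_var v = Poly_Mapping.single (Poly_Mapping.single v 1) 1"

definition vpoly_ring :: "'v vpoly ring" where
  "vpoly_ring = \<lparr>carrier = UNIV, mult = (*), one = 1, zero = 0, add = (+)\<rparr>"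

definition sym_ideal :: "(complex \<Rightarrow> 'v::ab_group_add \<Rightarrow> 'v) \<Rightarrow> 'v vpoly set" where
  "sym_ideal scale = genideal vpoly_ring
     ({vpoly_var (v + w) - vpoly_var v - vpoly_var w | v w. True} \<union>
      {vpoly_var (scale c v) - vpoly_const c * vpoly_var v | c v. True})"

definition sym_algebra ::
    "(complex \<Rightarrow> 'v::ab_group_add \<Rightarrow> 'v) \<Rightarrow> (complex, 'v vpoly set) module" where
  "sym_algebra scale =
     (let R = vpoly_ring; I = sym_ideal scale in
      \<lparr>carrier = carrier (R Quot I),
       mult = mult (R Quot I),
       one = \<one>\<^bsub>R Quot I\<^esub>,
       zero = \<zero>\<^bsub>R Quot I\<^esub>,
       add = add (R Quot I),
       smult = (\<lambda>c U. (I +>\<^bsub>R\<^esub> vpoly_const c) \<otimes>\<^bsub>R Quot I\<^esub> U)\<rparr>)"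

text \<open>The polynomial obtained by substituting the variable of \<open>f v\<close> for that of \<open>v\<close>.\<close>

definition vpoly_rename :: "('v \<Rightarrow> 'v) \<Rightarrow> 'v vpoly \<Rightarrow> 'v vpoly" where
  "vpoly_rename f p =
     (\<Sum>m\<in>Poly_Mapping.keys p.
        Poly_Mapping.single
          (\<Sum>v\<in>Poly_Mapping.keys m. Poly_Mapping.single (f v) (Poly_Mapping.lookup m v))
          (Poly_Mapping.lookup p m))"

text \<open>For linear \<open>f\<close> this is the algebra endomorphism of $S(V)$ extending \<open>f\<close>.\<close>

definition sym_map ::
    "(complex \<Rightarrow> 'v::ab_group_add \<Rightarrow> 'v) \<Rightarrow> ('v \<Rightarrow> 'v) \<Rightarrow> 'v vpoly set \<Rightarrow> 'v vpoly set" where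
  "sym_map scale f U = (\<Union>p\<in>U. sym_ideal scale +>\<^bsub>vpoly_ring\<^esub> vpoly_rename f p)"


section \<open>Skew group algebras\<close>

text \<open>
  For finite \<open>G\<close>, an element $\sum_g s_g \overline{g}$ of $S \# G$ is the function $g \mapsto s_g$,
  extended by \<open>undefined\<close> outside \<open>carrier G\<close>. The coefficient of $\overline{g}$ in a product is
  $\sum_{h} x_h \cdot {}^{h} y_{h^{-1}g}$.
\<close>

definition skew_group_algebra ::
    "('g, 'm) monoid_scheme \<Rightarrow> (complex, 's) module \<Rightarrow> ('g \<Rightarrow> 's \<Rightarrow> 's)
      \<Rightarrow> (complex, 'g \<Rightarrow> 's) module" where
  "skew_group_algebra G S act =
     \<lparr>carrier = carrier G \<rightarrow>\<^sub>E carrier S,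
      mult = (\<lambda>x y. \<lambda>g\<in>carrier G.
                \<Oplus>\<^bsub>S\<^esub>h\<in>carrier G. x h \<otimes>\<^bsub>S\<^esub> act h (y (inv\<^bsub>G\<^esub> h \<otimes>\<^bsub>G\<^esub> g))),
      one = (\<lambda>g\<in>carrier G. if g = \<one>\<^bsub>G\<^esub> then \<one>\<^bsub>S\<^esub> else \<zero>\<^bsub>S\<^esub>),
      zero = (\<lambda>g\<in>carrier G. \<zero>\<^bsub>S\<^esub>),
      add = (\<lambda>x y. \<lambda>g\<in>carrier G. x g \<oplus>\<^bsub>S\<^esub> y g),
      smult = (\<lambda>c x. \<lambda>g\<in>carrier G. c \<odot>\<^bsub>S\<^esub> x g)\<rparr>"

text \<open>
  The summand $S \overline{g}$ of $S \# G$. For \<open>g = \<one>\<close> it is the image of $S$ under the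
  inclusion $S \hookrightarrow S \# G$, and below it stands for $S$ itself.
\<close>

definition skew_component ::
    "('g, 'm) monoid_scheme \<Rightarrow> (complex, 's) module \<Rightarrow> 'g \<Rightarrow> ('g \<Rightarrow> 's) set" where
  "skew_component G S g =
     {x \<in> carrier G \<rightarrow>\<^sub>E carrier S. \<forall>h\<in>carrier G - {g}. x h = \<zero>\<^bsub>S\<^esub>}"


section \<open>Hochschild cohomology\<close>

text \<open>
  \<open>A\<close> is an algebra over the complex numbers, \<open>B\<close> a subalgebra and \<open>M\<close> a \<open>B\<close>-subbimodule of \<open>A\<close>.
  A cochain in $\mathrm{Hom}(B^{\otimes p}, M)$ is given by the corresponding multilinear map, as a
  function of the list of its \<open>p\<close> arguments.
\<close>

definition tuples :: "nat \<Rightarrow> 'a set \<Rightarrow> 'a list set" where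
  "tuples p B = {xs. length xs = p \<and> set xs \<subseteq> B}"

definition cochains ::
    "(complex, 'a) module \<Rightarrow> 'a set \<Rightarrow> 'a set \<Rightarrow> nat \<Rightarrow> ('a list \<Rightarrow> 'a) set" where
  "cochains A B M p =
     {f \<in> tuples p B \<rightarrow>\<^sub>E M. \<forall>xs\<in>tuples p B. \<forall>i<p.
        (\<forall>b\<in>B. f (xs[i := xs ! i \<oplus>\<^bsub>A\<^esub> b]) = f xs \<oplus>\<^bsub>A\<^esub> f (xs[i := b])) \<and>
        (\<forall>c. f (xs[i := c \<odot>\<^bsub>A\<^esub> xs ! i]) = c \<odot>\<^bsub>A\<^esub> f xs)}"

definition zero_cochain :: "(complex, 'a) module \<Rightarrow> 'a set \<Rightarrow> nat \<Rightarrow> 'a list \<Rightarrow> 'a" where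
  "zero_cochain A B p = (\<lambda>xs\<in>tuples p B. \<zero>\<^bsub>A\<^esub>)"

definition hochschild_d ::
    "(complex, 'a) module \<Rightarrow> 'a set \<Rightarrow> nat \<Rightarrow> ('a list \<Rightarrow> 'a) \<Rightarrow> 'a list \<Rightarrow> 'a" where
  "hochschild_d A B p f = (\<lambda>xs\<in>tuples (Suc p) B.
     (hd xs \<otimes>\<^bsub>A\<^esub> f (tl xs)) \<oplus>\<^bsub>A\<^esub>
     (\<Oplus>\<^bsub>A\<^esub>k\<in>{..<p}. (-1) ^ Suc k \<odot>\<^bsub>A\<^esub>
        f (take k xs @ (xs ! k \<otimes>\<^bsub>A\<^esub> xs ! Suc k) # drop (k + 2) xs)) \<oplus>\<^bsub>A\<^esub>
     ((-1) ^ Suc p \<odot>\<^bsub>A\<^esub> (f (butlast xs) \<otimes>\<^bsub>A\<^esub> last xs)))"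

definition cocycles ::
    "(complex, 'a) module \<Rightarrow> 'a set \<Rightarrow> 'a set \<Rightarrow> nat \<Rightarrow> ('a list \<Rightarrow> 'a) set" where
  "cocycles A B M p =
     {f \<in> cochains A B M p. hochschild_d A B p f = zero_cochain A B (Suc p)}"

definition coboundaries ::
    "(complex, 'a) module \<Rightarrow> 'a set \<Rightarrow> 'a set \<Rightarrow> nat \<Rightarrow> ('a list \<Rightarrow> 'a) set" where
  "coboundaries A B M p =
     (case p of 0 \<Rightarrow> {zero_cochain A B 0} | Suc q \<Rightarrow> hochschild_d A B q ` cochains A B M q)"

text \<open>
  The additive group of cocycles is written as a \<open>monoid\<close> record, so that the cohomology groups are
  library quotient groups; in particular the zero class is \<open>\<one>\<^bsub>HH A B M p\<^esub>\<close>.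
\<close>

definition cocycle_group ::
    "(complex, 'a) module \<Rightarrow> 'a set \<Rightarrow> 'a set \<Rightarrow> nat \<Rightarrow> ('a list \<Rightarrow> 'a) monoid" where
  "cocycle_group A B M p =
     \<lparr>carrier = cocycles A B M p,
      mult = (\<lambda>f f'. \<lambda>xs\<in>tuples p B. f xs \<oplus>\<^bsub>A\<^esub> f' xs),
      one = zero_cochain A B p\<rparr>"

definition HH ::
    "(complex, 'a) module \<Rightarrow> 'a set \<Rightarrow> 'a set \<Rightarrow> nat \<Rightarrow> ('a list \<Rightarrow> 'a) set monoid" where
  "HH A B M p = cocycle_group A B M p Mod coboundaries A B M p"

definition HH_class ::
    "(complex, 'a) module \<Rightarrow> 'a set \<Rightarrow> 'a set \<Rightarrow> nat \<Rightarrow> ('a list \<Rightarrow> 'a) \<Rightarrow> ('a list \<Rightarrow> 'a) set"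
    where
  "HH_class A B M p f = coboundaries A B M p #>\<^bsub>cocycle_group A B M p\<^esub> f"

text \<open>The map from $\mathrm{HH}^p(B, M)$ to $\mathrm{HH}^p(B', M')$ for \<open>B' \<subseteq> B\<close> and \<open>M \<subseteq> M'\<close>.\<close>

definition HH_map ::
    "(complex, 'a) module \<Rightarrow> 'a set \<Rightarrow> 'a set \<Rightarrow> nat \<Rightarrow> ('a list \<Rightarrow> 'a) set
      \<Rightarrow> ('a list \<Rightarrow> 'a) set" where
  "HH_map A B' M' p U = (\<Union>f\<in>U. HH_class A B' M' p (restrict f (tuples p B')))"

abbreviation HH_alg :: "(complex, 'a) module \<Rightarrow> nat \<Rightarrow> ('a list \<Rightarrow> 'a) set monoid" where
  "HH_alg A p \<equiv> HH A (carrier A) (carrier A) p"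


section \<open>The Gerstenhaber bracket\<close>

text \<open>
  Signs: \<open>p + 1\<close> and \<open>q + 1\<close> replace $p-1$ and $q-1$ in exponents, to avoid truncated subtraction.
  The index \<open>k\<close> counts from 0.
\<close>

definition circle_product ::
    "(complex, 'a) module \<Rightarrow> nat \<Rightarrow> nat \<Rightarrow> ('a list \<Rightarrow> 'a) \<Rightarrow> ('a list \<Rightarrow> 'a) \<Rightarrow> 'a list \<Rightarrow> 'a"
    where
  "circle_product A p q f f' = (\<lambda>xs\<in>tuples (p + q - 1) (carrier A).
     \<Oplus>\<^bsub>A\<^esub>k\<in>{..<p}. (-1) ^ ((q + 1) * k) \<odot>\<^bsub>A\<^esub>
       f (take k xs @ f' (take q (drop k xs)) # drop (k + q) xs))"

definition gerstenhaber_bracket ::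
    "(complex, 'a) module \<Rightarrow> nat \<Rightarrow> nat \<Rightarrow> ('a list \<Rightarrow> 'a) \<Rightarrow> ('a list \<Rightarrow> 'a) \<Rightarrow> 'a list \<Rightarrow> 'a"
    where
  "gerstenhaber_bracket A p q f f' = (\<lambda>xs\<in>tuples (p + q - 1) (carrier A).
     circle_product A p q f f' xs \<ominus>\<^bsub>A\<^esub>
     (-1) ^ ((p + 1) * (q + 1)) \<odot>\<^bsub>A\<^esub> circle_product A q p f' f xs)"

definition HH_bracket ::
    "(complex, 'a) module \<Rightarrow> nat \<Rightarrow> nat \<Rightarrow> ('a list \<Rightarrow> 'a) set \<Rightarrow> ('a list \<Rightarrow> 'a) set
      \<Rightarrow> ('a list \<Rightarrow> 'a) set" where
  "HH_bracket A p q U W =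
     (\<Union>f\<in>U. \<Union>f'\<in>W.
        HH_class A (carrier A) (carrier A) (p + q - 1) (gerstenhaber_bracket A p q f f'))"


section \<open>Support\<close>

text \<open>
  \<open>U\<close> is supported on \<open>W\<close> if its restriction to $S$ is a sum of classes coming from
  $\mathrm{HH}^p(S, S\overline{g})$ with \<open>g \<in> W\<close>; the sum is written as a product, see above.
\<close>

definition HH_supported_on ::
    "('g, 'm) monoid_scheme \<Rightarrow> (complex, 's) module \<Rightarrow> ('g \<Rightarrow> 's \<Rightarrow> 's) \<Rightarrow> nat \<Rightarrow> 'g set
      \<Rightarrow> (('g \<Rightarrow> 's) list \<Rightarrow> ('g \<Rightarrow> 's)) set \<Rightarrow> bool" where
  "HH_supported_on G S act p W U \<longleftrightarrow>
     (let A = skew_group_algebra G S act; S1 = skew_component G S \<one>\<^bsub>G\<^esub> in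
      \<exists>c. (\<forall>g\<in>W. c g \<in> carrier (HH A S1 (skew_component G S g) p)) \<and>
          HH_map A S1 (carrier A) p U =
            (\<Otimes>\<^bsub>HH A S1 (carrier A) p\<^esub>g\<in>W. HH_map A S1 (carrier A) p (c g)))"


section \<open>Linear actions\<close>

definition action_kernel :: "('g, 'm) monoid_scheme \<Rightarrow> ('g \<Rightarrow> 'v \<Rightarrow> 'v) \<Rightarrow> 'g set" where
  "action_kernel G \<rho> = {g \<in> carrier G. invariants UNIV \<rho> g = UNIV}"

abbreviation sym_act ::
    "(complex \<Rightarrow> 'v::ab_group_add \<Rightarrow> 'v) \<Rightarrow> ('g \<Rightarrow> 'v \<Rightarrow> 'v)
      \<Rightarrow> 'g \<Rightarrow> 'v vpoly set \<Rightarrow> 'v vpoly set" where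
  "sym_act scale \<rho> \<equiv> (\<lambda>g. sym_map scale (\<rho> g))"

abbreviation sym_skew ::
    "('g, 'm) monoid_scheme \<Rightarrow> (complex \<Rightarrow> 'v::ab_group_add \<Rightarrow> 'v) \<Rightarrow> ('g \<Rightarrow> 'v \<Rightarrow> 'v)
      \<Rightarrow> (complex, 'g \<Rightarrow> 'v vpoly set) module" where
  "sym_skew G scale \<rho> \<equiv> skew_group_algebra G (sym_algebra scale) (sym_act scale \<rho>)"

end

theory Submission
  imports Defs "HOL-Algebra.Multiplicative_Group"
begin

text \<open>
  For derivations \<open>E\<close>, \<open>D\<close> of an algebra the cup product \<open>f(a, b) = E a \<cdot> D b\<close> is a Hochschild
  2-cocycle. Since \<open>G\<close> is abelian, \<open>V\<close> has a basis of common eigenvectors; let \<open>x\<^sub>1, x\<^sub>2, x\<^sub>3\<close> be three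
  of them, \<open>D\<^sub>i = x\<^sub>i \<partial>/\<partial>x\<^sub>i\<close> and \<open>u = x\<^sub>2\<^sup>n\<close> with \<open>n = |G|\<close>. The derivations \<open>E = D\<^sub>1 - u D\<^sub>3\<close> and \<open>D = D\<^sub>2\<close>
  are \<open>G\<close>-equivariant and so extend to the skew group algebra. On three commuting elements of
  \<open>S(V)\<close>, the alternating sum of a coboundary is a sum of commutators, whose component at the
  identity of \<open>G\<close> vanishes. For \<open>[f, f]\<close> this component at \<open>x\<^sub>1, x\<^sub>2, x\<^sub>3\<close> is, up to sign,
  \<open>2 n u x\<^sub>1 x\<^sub>2 x\<^sub>3\<close>, so \<open>[f, f]\<close> is not a coboundary. For the second part take the zero class.
\<close>

section \<open>Associative complex algebras\<close>

text \<open>The fields D_i have weight zero for a diagonal action, so they commute with G whatever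
  the eigenvalues are. But they also commute with each other, and the Schouten square of E wedge D
  is a multiple of E wedge D wedge [E, D], so a product of two of them has square zero. The
  coefficient u is there to spoil this: [D, E] = -D_2(u) D_3 = -n u D_3, and the dimension bound
  supplies the third direction. For this u has to involve x_2 and to be invariant; the eigenvalues
  on x_2 are n-th roots of unity by Lagrange, whence the exponent n.

  The obstacle is to see that a class in HH^3 is nonzero without computing that group. A single
  functional that kills all coboundaries suffices, and taking an alternating sum also
  antisymmetrises f, which is a plain cup product. The identity component is the right one: for a in
  S(V) and any b, the commutator has component (a - g a) b_g at g, which vanishes for g = 1 but not
  in general.

  The support condition is met because f maps S(V) to S(V), and the identity of G always lies in
  K.\<close>

locale complex_algebra = ring A for A :: "(complex, 'a) module" (structure) +
  assumes smult_closed [simp, intro]: "x \<in> carrier A \<Longrightarrow> c \<odot> x \<in> carrier A"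
    and smult_l_distr: "x \<in> carrier A \<Longrightarrow> (c + d) \<odot> x = c \<odot> x \<oplus> d \<odot> x"
    and smult_r_distr: "\<lbrakk>x \<in> carrier A; y \<in> carrier A\<rbrakk> \<Longrightarrow> c \<odot> (x \<oplus> y) = c \<odot> x \<oplus> c \<odot> y"
    and smult_smult: "x \<in> carrier A \<Longrightarrow> c \<odot> (d \<odot> x) = (c * d) \<odot> x"
    and smult_one [simp]: "x \<in> carrier A \<Longrightarrow> 1 \<odot> x = x"
    and smult_mult_l: "\<lbrakk>x \<in> carrier A; y \<in> carrier A\<rbrakk> \<Longrightarrow> (c \<odot> x) \<otimes> y = c \<odot> (x \<otimes> y)"
    and smult_mult_r: "\<lbrakk>x \<in> carrier A; y \<in> carrier A\<rbrakk> \<Longrightarrow> x \<otimes> (c \<odot> y) = c \<odot> (x \<otimes> y)"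
begin

lemma smult_zero_l [simp]:
  assumes "x \<in> carrier A"
  shows "0 \<odot> x = \<zero>"
proof -
  have "0 \<odot> x = 0 \<odot> x \<oplus> 0 \<odot> x"
    using smult_l_distr[OF assms, of 0 0] by simp
  then show ?thesis
    using add.l_cancel_one' assms by auto
qed

lemma smult_zero_r [simp]: "c \<odot> \<zero> = \<zero>"
  by (metis l_null r_null smult_closed smult_mult_l zero_closed)

lemma smult_minus_one [simp]:
  assumes "x \<in> carrier A"
  shows "- 1 \<odot> x = \<ominus> x"
proof -
  have "- 1 \<odot> x \<oplus> x = \<zero>"
    using smult_l_distr[OF assms, of "- 1" 1] assms by simp
  then show ?thesis
    using assms minus_equality by auto
qed

lemma smult_minus: "x \<in> carrier A \<Longrightarrow> c \<odot> (\<ominus> x) = \<ominus> (c \<odot> x)"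
  by (metis minus_equality add.inv_closed add.l_inv smult_closed smult_r_distr smult_zero_r)

lemma smult_finsum:
  "f \<in> I \<rightarrow> carrier A \<Longrightarrow> c \<odot> finsum A f I = (\<Oplus>i\<in>I. c \<odot> f i)"
  by (induction I rule: infinite_finite_induct) (auto simp: smult_r_distr Pi_def)

lemma smult_left_commute: "x \<in> carrier A \<Longrightarrow> c \<odot> (d \<odot> x) = d \<odot> (c \<odot> x)"
  by (simp add: smult_smult mult.commute)

end

section \<open>Hochschild cochains\<close>

lemma tuples_update: "\<lbrakk>xs \<in> tuples p B; b \<in> B\<rbrakk> \<Longrightarrow> xs[i := b] \<in> tuples p B"
  by (auto simp: tuples_def dest!: set_update_subset_insert[THEN subsetD])

lemma tuples_nth: "\<lbrakk>xs \<in> tuples p B; i < p\<rbrakk> \<Longrightarrow> xs ! i \<in> B"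
  by (auto simp: tuples_def)

lemma tuples_Suc_hd_tl:
  assumes "xs \<in> tuples (Suc p) B"
  shows "hd xs \<in> B" "tl xs \<in> tuples p B"
  using assms by (cases xs; auto simp: tuples_def)+

lemma tuples_Suc_last_butlast:
  assumes "xs \<in> tuples (Suc p) B"
  shows "last xs \<in> B" "butlast xs \<in> tuples p B"
  using assms by (cases xs rule: rev_cases; auto simp: tuples_def)+

lemma tuples_two_iff: "xs \<in> tuples 2 B \<longleftrightarrow> (\<exists>x\<in>B. \<exists>y\<in>B. xs = [x, y])"
  by (auto simp: tuples_def length_Suc_conv numeral_2_eq_2)

lemma tuples_three_iff: "xs \<in> tuples 3 B \<longleftrightarrow> (\<exists>x\<in>B. \<exists>y\<in>B. \<exists>z\<in>B. xs = [x, y, z])"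
  by (auto simp: tuples_def length_Suc_conv numeral_3_eq_3)

lemma cochains_PiE: "f \<in> cochains A B M p \<Longrightarrow> f \<in> tuples p B \<rightarrow>\<^sub>E M"
  by (simp add: cochains_def)

text \<open>One context for the three situations that occur: \<open>B\<close> and \<open>M\<close>
  both the skew group algebra, \<open>B\<close> the copy of S(V) with \<open>M\<close> the whole
  algebra, and \<open>B\<close> the copy of S(V) with \<open>M\<close> one summand.\<close>

locale hochschild = complex_algebra A for A :: "(complex, 'a) module" (structure) +
  fixes B M :: "'a set"
  assumes B_subset: "B \<subseteq> carrier A"
    and B_add: "\<lbrakk>x \<in> B; y \<in> B\<rbrakk> \<Longrightarrow> x \<oplus> y \<in> B"
    and B_smult: "x \<in> B \<Longrightarrow> c \<odot> x \<in> B"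
    and B_mult: "\<lbrakk>x \<in> B; y \<in> B\<rbrakk> \<Longrightarrow> x \<otimes> y \<in> B"
    and M_subset: "M \<subseteq> carrier A"
    and M_zero: "\<zero> \<in> M"
    and M_add: "\<lbrakk>x \<in> M; y \<in> M\<rbrakk> \<Longrightarrow> x \<oplus> y \<in> M"
    and M_smult: "x \<in> M \<Longrightarrow> c \<odot> x \<in> M"
    and M_mult_l: "\<lbrakk>x \<in> B; y \<in> M\<rbrakk> \<Longrightarrow> x \<otimes> y \<in> M"
    and M_mult_r: "\<lbrakk>x \<in> M; y \<in> B\<rbrakk> \<Longrightarrow> x \<otimes> y \<in> M"
begin

lemma B_carrier: "x \<in> B \<Longrightarrow> x \<in> carrier A"
  using B_subset by auto

lemma M_carrier: "x \<in> M \<Longrightarrow> x \<in> carrier A"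
  using M_subset by auto

lemma cochains_M: "\<lbrakk>f \<in> cochains A B M p; xs \<in> tuples p B\<rbrakk> \<Longrightarrow> f xs \<in> M"
  by (auto simp: cochains_def)

lemma M_minus: "x \<in> M \<Longrightarrow> \<ominus> x \<in> M"
  using M_smult[of x "-1"] M_carrier by auto

lemma tuples_contract:
  assumes "xs \<in> tuples (Suc p) B" "k < p"
  shows "take k xs @ (xs ! k \<otimes> xs ! Suc k) # drop (k + 2) xs \<in> tuples p B"
  using assms B_mult
  by (auto simp: tuples_def subset_iff dest: in_set_takeD in_set_dropD)

lemma cochains_add:
  assumes f: "f \<in> cochains A B M p" and g: "g \<in> cochains A B M p"
  shows "(\<lambda>xs\<in>tuples p B. f xs \<oplus> g xs) \<in> cochains A B M p"
proof -
  have [simp]: "f xs \<in> carrier A" "g xs \<in> carrier A" if "xs \<in> tuples p B" for xs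
    using f g that M_subset by (auto simp: cochains_def)
  show ?thesis
    using f g cochains_M[OF f] cochains_M[OF g]
    by (auto simp: cochains_def tuples_update tuples_nth B_add B_smult M_add
      smult_r_distr a_ac)
qed

lemma cochains_smult:
  assumes f: "f \<in> cochains A B M p"
  shows "(\<lambda>xs\<in>tuples p B. c \<odot> f xs) \<in> cochains A B M p"
proof -
  have [simp]: "f xs \<in> carrier A" if "xs \<in> tuples p B" for xs
    using f that M_subset by (auto simp: cochains_def)
  show ?thesis
    using f cochains_M[OF f] by (auto simp: cochains_def tuples_update tuples_nth B_add B_smult M_smult
      smult_r_distr smult_left_commute)
qed

lemma zero_cochain_closed: "zero_cochain A B p \<in> cochains A B M p"
  by (auto simp: cochains_def zero_cochain_def tuples_update tuples_nth B_add B_smult M_zero)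

lemma hochschild_d_add:
  assumes "f \<in> cochains A B M p" "g \<in> cochains A B M p"
  shows "hochschild_d A B p (\<lambda>xs\<in>tuples p B. f xs \<oplus> g xs) =
    (\<lambda>xs\<in>tuples (Suc p) B. hochschild_d A B p f xs \<oplus> hochschild_d A B p g xs)"
proof -
  have [simp]: "f xs \<in> carrier A" "g xs \<in> carrier A" if "xs \<in> tuples p B" for xs
    using assms that M_subset by (auto simp: cochains_def)
  have "hd xs \<otimes> (f (tl xs) \<oplus> g (tl xs)) \<oplus>
      (\<Oplus>k\<in>{..<p}. (- 1) ^ Suc k \<odot> (\<lambda>xs\<in>tuples p B. f xs \<oplus> g xs)
          (take k xs @ (xs ! k \<otimes> xs ! Suc k) # drop (k + 2) xs)) \<oplus>
      (- 1) ^ Suc p \<odot> ((f (butlast xs) \<oplus> g (butlast xs)) \<otimes> last xs) =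
      hd xs \<otimes> f (tl xs) \<oplus>
      (\<Oplus>k\<in>{..<p}. (- 1) ^ Suc k \<odot> f (take k xs @ (xs ! k \<otimes> xs ! Suc k) # drop (k + 2) xs)) \<oplus>
      (- 1) ^ Suc p \<odot> (f (butlast xs) \<otimes> last xs) \<oplus>
      (hd xs \<otimes> g (tl xs) \<oplus>
      (\<Oplus>k\<in>{..<p}. (- 1) ^ Suc k \<odot> g (take k xs @ (xs ! k \<otimes> xs ! Suc k) # drop (k + 2) xs)) \<oplus>
      (- 1) ^ Suc p \<odot> (g (butlast xs) \<otimes> last xs))" (is "?l1 \<oplus> ?l2 \<oplus> ?l3 = ?f1 \<oplus> ?f2 \<oplus> ?f3 \<oplus> (?g1 \<oplus> ?g2 \<oplus> ?g3)")
    if xs: "xs \<in> tuples (Suc p) B" for xs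
  proof -
    note * = tuples_Suc_hd_tl[OF xs] tuples_Suc_last_butlast[OF xs]
    note con = tuples_contract[OF xs, simplified]
    have carr: "hd xs \<in> carrier A" "last xs \<in> carrier A"
      using * B_carrier by auto
    have 1: "?l1 = ?f1 \<oplus> ?g1" and 3: "?l3 = ?f3 \<oplus> ?g3"
      using * carr by (auto simp: r_distr l_distr smult_r_distr simp del: power_Suc)
    have "?l2 = (\<Oplus>k\<in>{..<p}.
        (- 1) ^ Suc k \<odot> f (take k xs @ (xs ! k \<otimes> xs ! Suc k) # drop (k + 2) xs) \<oplus>
        (- 1) ^ Suc k \<odot> g (take k xs @ (xs ! k \<otimes> xs ! Suc k) # drop (k + 2) xs))"
      using con by (intro finsum_cong') (auto simp: smult_r_distr simp del: power_Suc)
    also have "\<dots> = ?f2 \<oplus> ?g2"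
      using con by (intro finsum_addf) (auto simp del: power_Suc)
    finally have 2: "?l2 = ?f2 \<oplus> ?g2" .
    have "?f1 \<in> carrier A" "?f2 \<in> carrier A" "?f3 \<in> carrier A"
      "?g1 \<in> carrier A" "?g2 \<in> carrier A" "?g3 \<in> carrier A"
      using * carr con by (auto intro!: finsum_closed simp del: power_Suc)
    then show ?thesis
      unfolding 1 2 3 by (simp add: a_ac)
  qed
  then show ?thesis
    by (auto simp: hochschild_d_def tuples_Suc_hd_tl tuples_Suc_last_butlast intro!: restrict_ext)
qed

lemma hochschild_d_smult:
  assumes "f \<in> cochains A B M p"
  shows "hochschild_d A B p (\<lambda>xs\<in>tuples p B. c \<odot> f xs) =
    (\<lambda>xs\<in>tuples (Suc p) B. c \<odot> hochschild_d A B p f xs)"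
proof -
  have [simp]: "f xs \<in> carrier A" if "xs \<in> tuples p B" for xs
    using assms that M_subset by (auto simp: cochains_def)
  have "hd xs \<otimes> (c \<odot> f (tl xs)) \<oplus>
      (\<Oplus>k\<in>{..<p}. (- 1) ^ Suc k \<odot> (\<lambda>xs\<in>tuples p B. c \<odot> f xs)
          (take k xs @ (xs ! k \<otimes> xs ! Suc k) # drop (k + 2) xs)) \<oplus>
      (- 1) ^ Suc p \<odot> ((c \<odot> f (butlast xs)) \<otimes> last xs) =
      c \<odot> (hd xs \<otimes> f (tl xs) \<oplus>
      (\<Oplus>k\<in>{..<p}. (- 1) ^ Suc k \<odot> f (take k xs @ (xs ! k \<otimes> xs ! Suc k) # drop (k + 2) xs)) \<oplus>
      (- 1) ^ Suc p \<odot> (f (butlast xs) \<otimes> last xs))" (is "?l1 \<oplus> ?l2 \<oplus> ?l3 = c \<odot> (?f1 \<oplus> ?f2 \<oplus> ?f3)")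
    if xs: "xs \<in> tuples (Suc p) B" for xs
  proof -
    note * = tuples_Suc_hd_tl[OF xs] tuples_Suc_last_butlast[OF xs]
    note con = tuples_contract[OF xs, simplified]
    have carr: "hd xs \<in> carrier A" "last xs \<in> carrier A"
      using * B_carrier by auto
    have 1: "?l1 = c \<odot> ?f1" and 3: "?l3 = c \<odot> ?f3"
      using * carr
      by (simp_all add: smult_mult_l smult_mult_r smult_smult mult.commute del: power_Suc)
    have "?l2 = (\<Oplus>k\<in>{..<p}.
        c \<odot> ((- 1) ^ Suc k \<odot> f (take k xs @ (xs ! k \<otimes> xs ! Suc k) # drop (k + 2) xs)))"
      using con by (intro finsum_cong') (auto simp: smult_smult mult.commute simp del: power_Suc)
    also have "\<dots> = c \<odot> ?f2"
      using con by (intro smult_finsum[symmetric]) (auto simp del: power_Suc)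
    finally have 2: "?l2 = c \<odot> ?f2" .
    have "?f1 \<in> carrier A" "?f2 \<in> carrier A" "?f3 \<in> carrier A"
      using * carr con by (auto intro!: finsum_closed simp del: power_Suc)
    then show ?thesis
      unfolding 1 2 3 by (simp add: smult_r_distr)
  qed
  then show ?thesis
    by (auto simp: hochschild_d_def tuples_Suc_hd_tl tuples_Suc_last_butlast intro!: restrict_ext)
qed

text \<open>Concerns values only. That the differential is again multilinear is proved below just
  for 1-cochains, from the explicit formula.\<close>

lemma hochschild_d_closed:
  assumes "f \<in> cochains A B M p"
  shows "hochschild_d A B p f \<in> tuples (Suc p) B \<rightarrow>\<^sub>E M"
proof -
  have f: "f xs \<in> M" if "xs \<in> tuples p B" for xs
    using assms that by (auto simp: cochains_def)
  have fs: "finsum A h I \<in> M" if "\<And>i. i \<in> I \<Longrightarrow> h i \<in> M" for h and I :: "nat set"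
    using that
    by (induction I rule: infinite_finite_induct) (auto simp: M_zero M_add M_carrier Pi_def)
  show ?thesis
    unfolding hochschild_d_def restrict_PiE_iff
    by (intro ballI M_add M_mult_l M_mult_r M_smult fs f)
      (auto dest: tuples_Suc_hd_tl tuples_Suc_last_butlast tuples_contract)
qed

lemma zero_cocycle: "zero_cochain A B p \<in> cocycles A B M p"
proof -
  have "zero_cochain A B p = (\<lambda>xs\<in>tuples p B. 0 \<odot> zero_cochain A B p xs)"
    by (auto simp: zero_cochain_def)
  then have "hochschild_d A B p (zero_cochain A B p) =
      (\<lambda>xs\<in>tuples (Suc p) B. 0 \<odot> hochschild_d A B p (zero_cochain A B p) xs)"
    using hochschild_d_smult[OF zero_cochain_closed, of p 0] by simp
  also have "\<dots> = zero_cochain A B (Suc p)"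
    unfolding zero_cochain_def[of A B "Suc p"]
    using hochschild_d_closed[OF zero_cochain_closed, of p] M_carrier
    by (intro restrict_ext) (simp add: PiE_iff)
  finally have "hochschild_d A B p (zero_cochain A B p) = zero_cochain A B (Suc p)" .
  then show ?thesis
    by (simp add: cocycles_def zero_cochain_closed)
qed

lemma comm_group_cocycles: "comm_group (cocycle_group A B M p)"
proof -
  note d = hochschild_d_add hochschild_d_smult
  have carr: "f xs \<in> carrier A" if "f \<in> cocycles A B M p" "xs \<in> tuples p B" for f xs
    using that M_subset by (auto simp: cochains_def cocycles_def)
  have ext: "restrict f (tuples p B) = f" if "f \<in> cocycles A B M p" for f
    using that by (auto simp: cochains_def cocycles_def PiE_restrict)
  show ?thesis
  proof (rule comm_groupI)
    fix f g assume "f \<in> carrier (cocycle_group A B M p)" "g \<in> carrier (cocycle_group A B M p)"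
    then show "f \<otimes>\<^bsub>cocycle_group A B M p\<^esub> g \<in> carrier (cocycle_group A B M p)"
      by (auto simp: cocycle_group_def cocycles_def cochains_add d zero_cochain_def intro!: restrict_ext)
  next
    show "\<one>\<^bsub>cocycle_group A B M p\<^esub> \<in> carrier (cocycle_group A B M p)"
      by (simp add: cocycle_group_def zero_cocycle)
  next
    fix f assume "f \<in> carrier (cocycle_group A B M p)"
    then have f: "f \<in> cocycles A B M p"
      by (simp add: cocycle_group_def)
    have "\<one>\<^bsub>cocycle_group A B M p\<^esub> \<otimes>\<^bsub>cocycle_group A B M p\<^esub> f = restrict f (tuples p B)"
      using carr[OF f] by (simp add: cocycle_group_def zero_cochain_def cong: restrict_cong)
    then show "\<one>\<^bsub>cocycle_group A B M p\<^esub> \<otimes>\<^bsub>cocycle_group A B M p\<^esub> f = f"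
      by (simp only: ext[OF f])
    let ?g = "\<lambda>xs\<in>tuples p B. -1 \<odot> f xs"
    show "\<exists>g\<in>carrier (cocycle_group A B M p). g \<otimes>\<^bsub>cocycle_group A B M p\<^esub> f = \<one>\<^bsub>cocycle_group A B M p\<^esub>"
    proof (rule bexI[of _ ?g])
      show "?g \<in> carrier (cocycle_group A B M p)"
        using f by (simp add: cocycle_group_def cocycles_def cochains_smult d zero_cochain_def
            cong: restrict_cong)
      show "?g \<otimes>\<^bsub>cocycle_group A B M p\<^esub> f = \<one>\<^bsub>cocycle_group A B M p\<^esub>"
        using carr[OF f] by (simp add: cocycle_group_def zero_cochain_def l_neg cong: restrict_cong)
    qed
  qed (auto simp: cocycle_group_def carr a_ac intro!: restrict_ext)
qed

end

section \<open>Explicit formulas in degrees one and two; cohomology classes\<close>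

context hochschild
begin

lemma cochain_add:
  assumes "f \<in> cochains A B M p" "xs \<in> tuples p B" "i < p" "b \<in> B"
  shows "f (xs[i := xs ! i \<oplus> b]) = f xs \<oplus> f (xs[i := b])"
  using assms by (auto simp: cochains_def)

lemma cochain_smult:
  assumes "f \<in> cochains A B M p" "xs \<in> tuples p B" "i < p"
  shows "f (xs[i := c \<odot> xs ! i]) = c \<odot> f xs"
  using assms by (auto simp: cochains_def)

lemma cochain1_closed: "\<lbrakk>f \<in> cochains A B M 1; x \<in> B\<rbrakk> \<Longrightarrow> f [x] \<in> M"
  using cochains_M[of f 1 "[x]"] by (simp add: tuples_def)

lemma cochain1_add:
  "\<lbrakk>f \<in> cochains A B M 1; x \<in> B; y \<in> B\<rbrakk> \<Longrightarrow> f [x \<oplus> y] = f [x] \<oplus> f [y]"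
  using cochain_add[of f 1 "[x]" 0 y] by (simp add: tuples_def)

lemma cochain1_smult:
  "\<lbrakk>f \<in> cochains A B M 1; x \<in> B\<rbrakk> \<Longrightarrow> f [c \<odot> x] = c \<odot> f [x]"
  using cochain_smult[of f 1 "[x]" 0 c] by (simp add: tuples_def)

lemma cochain2_closed: "\<lbrakk>f \<in> cochains A B M 2; x \<in> B; y \<in> B\<rbrakk> \<Longrightarrow> f [x, y] \<in> M"
  using cochains_M[of f 2 "[x, y]"] by (simp add: tuples_def)

lemma cochain2_add:
  assumes "f \<in> cochains A B M 2" "x \<in> B" "y \<in> B" "z \<in> B"
  shows "f [x \<oplus> y, z] = f [x, z] \<oplus> f [y, z]" "f [x, y \<oplus> z] = f [x, y] \<oplus> f [x, z]"
  using cochain_add[of f 2 "[x, z]" 0 y] cochain_add[of f 2 "[x, y]" 1 z] assms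
  by (simp_all add: tuples_def)

lemma cochain2_smult:
  assumes "f \<in> cochains A B M 2" "x \<in> B" "y \<in> B"
  shows "f [c \<odot> x, y] = c \<odot> f [x, y]" "f [x, c \<odot> y] = c \<odot> f [x, y]"
  using cochain_smult[of f 2 "[x, y]" 0 c] cochain_smult[of f 2 "[x, y]" 1 c] assms
  by (simp_all add: tuples_def)

lemma cochain2I:
  assumes "\<And>x y. \<lbrakk>x \<in> B; y \<in> B\<rbrakk> \<Longrightarrow> F x y \<in> M"
    and "\<And>x y z. \<lbrakk>x \<in> B; y \<in> B; z \<in> B\<rbrakk> \<Longrightarrow> F (x \<oplus> y) z = F x z \<oplus> F y z"
    and "\<And>x y z. \<lbrakk>x \<in> B; y \<in> B; z \<in> B\<rbrakk> \<Longrightarrow> F x (y \<oplus> z) = F x y \<oplus> F x z"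
    and "\<And>x y c. \<lbrakk>x \<in> B; y \<in> B\<rbrakk> \<Longrightarrow> F (c \<odot> x) y = c \<odot> F x y"
    and "\<And>x y c. \<lbrakk>x \<in> B; y \<in> B\<rbrakk> \<Longrightarrow> F x (c \<odot> y) = c \<odot> F x y"
  shows "(\<lambda>xs\<in>tuples 2 B. F (xs ! 0) (xs ! 1)) \<in> cochains A B M 2"
proof -
  have mem: "[x, y] \<in> tuples 2 B \<longleftrightarrow> x \<in> B \<and> y \<in> B" for x y
    by (simp add: tuples_def)
  have "\<exists>x\<in>B. \<exists>y\<in>B. xs = [x, y]" if "xs \<in> tuples 2 B" for xs
    using that by (simp add: tuples_two_iff)
  then show ?thesis
    unfolding cochains_def using assms
    by (fastforce simp: mem B_add B_smult less_2_cases_iff)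
qed

lemma hochschild_d_1:
  assumes "f \<in> cochains A B M 1" "x \<in> B" "y \<in> B"
  shows "hochschild_d A B 1 f [x, y] = x \<otimes> f [y] \<ominus> f [x \<otimes> y] \<oplus> f [x] \<otimes> y"
proof -
  have "f [z] \<in> carrier A" if "z \<in> B" for z
    using cochain1_closed[OF assms(1) that] M_carrier by auto
  then show ?thesis
    using assms B_carrier
    by (simp add: hochschild_d_def tuples_def lessThan_Suc Pi_def minus_eq B_mult)
qed

lemma hochschild_d_2:
  assumes "f \<in> cochains A B M 2" "x \<in> B" "y \<in> B" "z \<in> B"
  shows "hochschild_d A B 2 f [x, y, z] =
    x \<otimes> f [y, z] \<ominus> f [x \<otimes> y, z] \<oplus> f [x, y \<otimes> z] \<ominus> f [x, y] \<otimes> z"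
proof -
  have "f [z, w] \<in> carrier A" if "z \<in> B" "w \<in> B" for z w
    using cochain2_closed[OF assms(1) that] M_carrier by auto
  then show ?thesis
    using assms B_carrier
    by (simp add: hochschild_d_def tuples_def numeral_2_eq_2 lessThan_Suc Pi_def minus_eq B_mult a_ac)
qed

lemma coboundaries_2: "coboundaries A B M 2 = hochschild_d A B 1 ` cochains A B M 1"
  by (simp add: coboundaries_def numeral_2_eq_2)

lemma coboundaries_3: "coboundaries A B M 3 = hochschild_d A B 2 ` cochains A B M 2"
  by (simp add: coboundaries_def numeral_3_eq_3 numeral_2_eq_2)

lemma coboundaries_PiE:
  assumes "f \<in> coboundaries A B M p"
  shows "f \<in> tuples p B \<rightarrow>\<^sub>E M"
proof (cases p)
  case 0
  then show ?thesis
    using assms cochains_PiE[OF zero_cochain_closed, of 0] by (simp add: coboundaries_def)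
next
  case (Suc q)
  then show ?thesis
    using assms hochschild_d_closed by (auto simp: coboundaries_def)
qed

lemma coboundaries_carrier:
  "\<lbrakk>f \<in> coboundaries A B M p; xs \<in> tuples p B\<rbrakk> \<Longrightarrow> f xs \<in> carrier A"
  using coboundaries_PiE M_carrier by blast

lemma coboundaries_zero: "zero_cochain A B p \<in> coboundaries A B M p"
proof (cases p)
  case (Suc q)
  have "hochschild_d A B q (zero_cochain A B q) = zero_cochain A B (Suc q)"
    using zero_cocycle[of q] by (simp add: cocycles_def)
  then show ?thesis
    using Suc zero_cochain_closed[of q] by (auto simp: coboundaries_def image_iff intro: sym)
qed (simp add: coboundaries_def)

lemma coboundaries_add:
  assumes "f \<in> coboundaries A B M p" "g \<in> coboundaries A B M p"
  shows "(\<lambda>xs\<in>tuples p B. f xs \<oplus> g xs) \<in> coboundaries A B M p"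
proof (cases p)
  case 0
  then show ?thesis
    using assms by (auto simp: coboundaries_def zero_cochain_def intro!: restrict_ext)
next
  case (Suc q)
  then obtain u v where uv: "u \<in> cochains A B M q" "v \<in> cochains A B M q"
    "f = hochschild_d A B q u" "g = hochschild_d A B q v"
    using assms by (auto simp: coboundaries_def)
  then show ?thesis
    using hochschild_d_add[OF uv(1,2)] cochains_add[OF uv(1,2)] Suc
    by (auto simp: coboundaries_def image_iff intro: sym)
qed

lemma coboundaries_minus:
  assumes "f \<in> coboundaries A B M p"
  shows "(\<lambda>xs\<in>tuples p B. \<ominus> f xs) \<in> coboundaries A B M p"
proof (cases p)
  case 0
  then show ?thesis
    using assms by (auto simp: coboundaries_def zero_cochain_def intro!: restrict_ext)
next
  case (Suc q)
  then obtain u where u: "u \<in> cochains A B M q" "f = hochschild_d A B q u"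
    using assms by (auto simp: coboundaries_def)
  have "(\<lambda>xs\<in>tuples p B. \<ominus> f xs) = (\<lambda>xs\<in>tuples p B. - 1 \<odot> f xs)"
    using coboundaries_carrier[OF assms] by (intro restrict_ext) simp
  then show ?thesis
    using hochschild_d_smult[OF u(1), of "-1"] cochains_smult[OF u(1), of "-1"] Suc u(2)
    by (auto simp: coboundaries_def image_iff intro: sym)
qed

lemma HH_class_eq:
  "HH_class A B M p f = (\<lambda>h. \<lambda>xs\<in>tuples p B. h xs \<oplus> f xs) ` coboundaries A B M p"
  by (auto simp: HH_class_def r_coset_def cocycle_group_def)

text \<open>Classes are handled as translates of the set of coboundaries, in every degree and for
  any \<open>f\<close> with values in the algebra. The identity d d = 0 is established only on
  1-cochains, so the coset calculus of a quotient group is at hand in degree 2 only, whereas the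
  bracket lives in degree 3.\<close>

lemma HH_class_add_coboundary:
  assumes f: "f \<in> tuples p B \<rightarrow> carrier A" and k: "k \<in> coboundaries A B M p"
  shows "HH_class A B M p (\<lambda>xs\<in>tuples p B. k xs \<oplus> f xs) = HH_class A B M p f"
proof -
  note carr = coboundaries_carrier[OF k] funcset_mem[OF f]
  have "\<exists>h'\<in>coboundaries A B M p. (\<lambda>xs\<in>tuples p B. h xs \<oplus> (k xs \<oplus> f xs)) =
      (\<lambda>xs\<in>tuples p B. h' xs \<oplus> f xs)"
    if h: "h \<in> coboundaries A B M p" for h
    by (rule bexI[OF _ coboundaries_add[OF h k]])
      (auto simp: a_assoc carr coboundaries_carrier[OF h] intro!: restrict_ext)
  moreover have "\<exists>h'\<in>coboundaries A B M p. (\<lambda>xs\<in>tuples p B. h xs \<oplus> f xs) =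
      (\<lambda>xs\<in>tuples p B. h' xs \<oplus> (k xs \<oplus> f xs))"
    if h: "h \<in> coboundaries A B M p" for h
    by (rule bexI[OF _ coboundaries_add[OF h coboundaries_minus[OF k]]])
      (auto simp: a_assoc r_neg2 r_neg1 carr coboundaries_carrier[OF h] intro!: restrict_ext)
  ultimately show ?thesis
    unfolding HH_class_eq by (auto simp: image_iff cong: restrict_cong)
qed

lemma HH_class_coboundary:
  assumes k: "k \<in> coboundaries A B M p"
  shows "HH_class A B M p k = coboundaries A B M p"
proof -
  have "restrict h (tuples p B) = h" if "h \<in> coboundaries A B M p" for h
    using coboundaries_PiE[OF that] by (simp add: PiE_restrict)
  then have "HH_class A B M p (zero_cochain A B p) = (\<lambda>h. h) ` coboundaries A B M p"
    unfolding HH_class_eq using coboundaries_carrier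
    by (intro image_cong) (simp_all add: zero_cochain_def cong: restrict_cong)
  moreover have "(\<lambda>xs\<in>tuples p B. k xs \<oplus> zero_cochain A B p xs) = restrict k (tuples p B)"
    using coboundaries_carrier[OF k] by (simp add: zero_cochain_def cong: restrict_cong)
  moreover have "\<dots> = k"
    using coboundaries_PiE[OF k] by (simp add: PiE_restrict)
  ultimately show ?thesis
    using HH_class_add_coboundary[OF _ k, of "zero_cochain A B p"] by (simp add: zero_cochain_def)
qed

lemma HH_class_self:
  assumes "f \<in> tuples p B \<rightarrow>\<^sub>E carrier A"
  shows "f \<in> HH_class A B M p f"
proof -
  have "(\<lambda>xs\<in>tuples p B. zero_cochain A B p xs \<oplus> f xs) = restrict f (tuples p B)"
    using assms by (intro restrict_ext) (auto simp: zero_cochain_def PiE_iff)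
  also have "\<dots> = f"
    using assms by (simp add: PiE_restrict)
  finally show ?thesis
    unfolding HH_class_eq by (intro image_eqI[OF _ coboundaries_zero]) simp
qed

lemma one_HH: "\<one>\<^bsub>HH A B M p\<^esub> = coboundaries A B M p"
  by (simp add: HH_def FactGroup_def)

lemma HH_class_closed: "f \<in> cocycles A B M p \<Longrightarrow> HH_class A B M p f \<in> carrier (HH A B M p)"
  by (auto simp: HH_def FactGroup_def RCOSETS_def HH_class_def cocycle_group_def)

lemma cocycle_2_iff:
  assumes "f \<in> cochains A B M 2"
  shows "f \<in> cocycles A B M 2 \<longleftrightarrow> (\<forall>x\<in>B. \<forall>y\<in>B. \<forall>z\<in>B.
    x \<otimes> f [y, z] \<ominus> f [x \<otimes> y, z] \<oplus> f [x, y \<otimes> z] \<ominus> f [x, y] \<otimes> z = \<zero>)" (is "_ \<longleftrightarrow> ?R")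
proof -
  have "hochschild_d A B 2 f = zero_cochain A B 3 \<longleftrightarrow>
      (\<forall>xs\<in>tuples 3 B. hochschild_d A B 2 f xs = zero_cochain A B 3 xs)"
    using hochschild_d_closed[OF assms]
    by (auto simp: zero_cochain_def PiE_def numeral_3_eq_3 numeral_2_eq_2 intro!: extensionalityI)
  also have "\<dots> \<longleftrightarrow> ?R"
    using hochschild_d_2[OF assms] by (fastforce simp: tuples_three_iff zero_cochain_def)
  finally show ?thesis
    using assms by (auto simp: cocycles_def numeral_3_eq_3 numeral_2_eq_2)
qed

lemma hochschild_d_1_cochain:
  assumes f: "f \<in> cochains A B M 1"
  shows "hochschild_d A B 1 f \<in> cochains A B M 2"
proof -
  note [simp] = cochain1_add[OF f] cochain1_smult[OF f] B_add B_smult B_mult B_carrier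
    M_carrier[OF cochain1_closed[OF f]]
  have "hochschild_d A B 1 f =
      (\<lambda>xs\<in>tuples 2 B. xs ! 0 \<otimes> f [xs ! 1] \<ominus> f [xs ! 0 \<otimes> xs ! 1] \<oplus> f [xs ! 0] \<otimes> xs ! 1)"
    using hochschild_d_closed[OF f] hochschild_d_1[OF f]
    by (intro extensionalityI[of _ "tuples 2 B"])
      (auto simp: PiE_def tuples_two_iff numeral_2_eq_2[symmetric])
  also have "\<dots> \<in> cochains A B M 2"
  proof (rule cochain2I)
    show "x \<otimes> f [y] \<ominus> f [x \<otimes> y] \<oplus> f [x] \<otimes> y \<in> M" if "x \<in> B" "y \<in> B" for x y
      using that cochain1_closed[OF f]
      by (simp add: minus_eq M_add M_minus M_mult_l M_mult_r)
  next
    show "(x \<oplus> y) \<otimes> f [z] \<ominus> f [(x \<oplus> y) \<otimes> z] \<oplus> f [x \<oplus> y] \<otimes> z =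
        x \<otimes> f [z] \<ominus> f [x \<otimes> z] \<oplus> f [x] \<otimes> z \<oplus> (y \<otimes> f [z] \<ominus> f [y \<otimes> z] \<oplus> f [y] \<otimes> z)"
      if "x \<in> B" "y \<in> B" "z \<in> B" for x y z
      using that by (simp add: l_distr minus_eq minus_add a_ac)
  next
    show "x \<otimes> f [y \<oplus> z] \<ominus> f [x \<otimes> (y \<oplus> z)] \<oplus> f [x] \<otimes> (y \<oplus> z) =
        x \<otimes> f [y] \<ominus> f [x \<otimes> y] \<oplus> f [x] \<otimes> y \<oplus> (x \<otimes> f [z] \<ominus> f [x \<otimes> z] \<oplus> f [x] \<otimes> z)"
      if "x \<in> B" "y \<in> B" "z \<in> B" for x y z
      using that by (simp add: r_distr minus_eq minus_add a_ac)
  qed (simp_all add: smult_mult_l smult_mult_r minus_eq smult_r_distr smult_minus)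
  finally show ?thesis .
qed

lemma coboundaries_2_subset: "coboundaries A B M 2 \<subseteq> cocycles A B M 2"
proof
  fix h assume "h \<in> coboundaries A B M 2"
  then obtain f where f: "f \<in> cochains A B M 1" and h: "h = hochschild_d A B 1 f"
    by (auto simp: coboundaries_2)
  note [simp] = B_carrier B_mult M_carrier[OF cochain1_closed[OF f]] hochschild_d_1[OF f]
  have "x \<otimes> h [y, z] \<ominus> h [x \<otimes> y, z] \<oplus> h [x, y \<otimes> z] \<ominus> h [x, y] \<otimes> z = \<zero>"
    if "x \<in> B" "y \<in> B" "z \<in> B" for x y z
  proof -
    \<comment> \<open>The values of \<open>f\<close> are treated as independent elements, with
      products of arguments normalised by associativity; then d d = 0 is an identity in a
      noncommutative ring.\<close>
    have carr: "x \<in> carrier A" "y \<in> carrier A" "z \<in> carrier A" "f [x] \<in> carrier A" "f [y] \<in> carrier A"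
      "f [z] \<in> carrier A" "f [x \<otimes> y] \<in> carrier A" "f [y \<otimes> z] \<in> carrier A"
      "f [x \<otimes> (y \<otimes> z)] \<in> carrier A"
      using that by auto
    have "x \<otimes> (y \<otimes> f [z] \<ominus> f [y \<otimes> z] \<oplus> f [y] \<otimes> z) \<ominus>
      (x \<otimes> y \<otimes> f [z] \<ominus> f [x \<otimes> (y \<otimes> z)] \<oplus> f [x \<otimes> y] \<otimes> z) \<oplus>
      (x \<otimes> f [y \<otimes> z] \<ominus> f [x \<otimes> (y \<otimes> z)] \<oplus> f [x] \<otimes> (y \<otimes> z)) \<ominus>
      (x \<otimes> f [y] \<ominus> f [x \<otimes> y] \<oplus> f [x] \<otimes> y) \<otimes> z = \<zero>"
      using carr by algebra
    then show ?thesis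
      using that unfolding h by (simp only: hochschild_d_1[OF f] B_mult m_assoc carr)
  qed
  then show "h \<in> cocycles A B M 2"
    using hochschild_d_1_cochain[OF f] by (simp add: cocycle_2_iff h)
qed

text \<open>The support condition is a finite product in this group, and evaluating it requires
  commutativity.\<close>

lemma comm_group_HH_2: "comm_group (HH A B M 2)"
  unfolding HH_def
proof (rule comm_group.abelian_FactGroup[OF comm_group_cocycles])
  interpret Z: comm_group "cocycle_group A B M 2"
    by (rule comm_group_cocycles)
  show "subgroup (coboundaries A B M 2) (cocycle_group A B M 2)"
  proof (rule Z.subgroupI)
    show "coboundaries A B M 2 \<subseteq> carrier (cocycle_group A B M 2)"
      using coboundaries_2_subset by (simp add: cocycle_group_def)
    show "coboundaries A B M 2 \<noteq> {}"
      using coboundaries_zero by auto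
    fix f assume f: "f \<in> coboundaries A B M 2"
    have "(\<lambda>xs\<in>tuples 2 B. \<ominus> f xs) \<otimes>\<^bsub>cocycle_group A B M 2\<^esub> f = \<one>\<^bsub>cocycle_group A B M 2\<^esub>"
      using coboundaries_carrier[OF f]
      by (simp add: cocycle_group_def zero_cochain_def l_neg cong: restrict_cong)
    then have "inv\<^bsub>cocycle_group A B M 2\<^esub> f = (\<lambda>xs\<in>tuples 2 B. \<ominus> f xs)"
      using f coboundaries_minus[OF f] coboundaries_2_subset
      by (intro Z.inv_equality) (auto simp: cocycle_group_def)
    then show "inv\<^bsub>cocycle_group A B M 2\<^esub> f \<in> coboundaries A B M 2"
      using coboundaries_minus[OF f] by simp
  next
    fix f g assume "f \<in> coboundaries A B M 2" "g \<in> coboundaries A B M 2"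
    then show "f \<otimes>\<^bsub>cocycle_group A B M 2\<^esub> g \<in> coboundaries A B M 2"
      using coboundaries_add by (simp add: cocycle_group_def)
  qed
qed

end

section \<open>Restricting the arguments and enlarging the coefficients\<close>

lemma restrict_hochschild_d:
  assumes "hochschild A B M" "hochschild A B' M'" "B' \<subseteq> B" "g \<in> cochains A B M q"
  shows "restrict (hochschild_d A B q g) (tuples (Suc q) B') =
    hochschild_d A B' q (restrict g (tuples q B'))"
proof -
  interpret hochschild A B M by fact
  interpret H': hochschild A B' M' by fact
  have carr: "g xs \<in> carrier A" if "xs \<in> tuples q B" for xs
    using cochains_M[OF assms(4) that] M_carrier by auto
  have sub: "xs \<in> tuples p B" if "xs \<in> tuples p B'" for xs p
    using that assms(3) by (auto simp: tuples_def)
  have "(\<Oplus>\<^bsub>A\<^esub>k\<in>{..<q}. (- 1) ^ Suc k \<odot>\<^bsub>A\<^esub> g (take k xs @ (xs ! k \<otimes>\<^bsub>A\<^esub> xs ! Suc k) # drop (k + 2) xs)) =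
      (\<Oplus>\<^bsub>A\<^esub>k\<in>{..<q}. (- 1) ^ Suc k \<odot>\<^bsub>A\<^esub>
        restrict g (tuples q B') (take k xs @ (xs ! k \<otimes>\<^bsub>A\<^esub> xs ! Suc k) # drop (k + 2) xs))"
    if "xs \<in> tuples (Suc q) B'" for xs
    using H'.tuples_contract[OF that] sub carr
    by (intro finsum_cong') (auto simp del: power_Suc)
  then show ?thesis
    using sub tuples_Suc_hd_tl[of _ q B'] tuples_Suc_last_butlast[of _ q B']
    by (auto simp: hochschild_d_def simp del: power_Suc intro!: ext)
qed

lemma restrict_cochain:
  assumes "f \<in> cochains A B M p" "B' \<subseteq> B" "M \<subseteq> M'" "hochschild A B' M'"
  shows "restrict f (tuples p B') \<in> cochains A B' M' p"
proof -
  interpret hochschild A B' M' by fact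
  have sub: "xs \<in> tuples p B" if "xs \<in> tuples p B'" for xs p
    using that assms(2) by (auto simp: tuples_def)
  show ?thesis
    using assms(1-3) sub
    by (auto simp: cochains_def tuples_update tuples_nth B_add B_smult subset_iff PiE_iff)
qed

lemma restrict_coboundary:
  assumes "f \<in> coboundaries A B M p" "B' \<subseteq> B" "M \<subseteq> M'" "hochschild A B M" "hochschild A B' M'"
  shows "restrict f (tuples p B') \<in> coboundaries A B' M' p"
proof (cases p)
  case 0
  then show ?thesis
    using assms by (auto simp: coboundaries_def zero_cochain_def tuples_def)
next
  case (Suc q)
  then obtain g where g: "g \<in> cochains A B M q" "f = hochschild_d A B q g"
    using assms(1) by (auto simp: coboundaries_def)
  then show ?thesis
    using Suc restrict_hochschild_d[OF assms(4,5,2) g(1)] restrict_cochain[OF g(1) assms(2,3,5)]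
    by (auto simp: coboundaries_def)
qed

text \<open>\<open>HH_map\<close> is a union over all representatives. Two of them differ by a
  coboundary, which restricts to a coboundary, so all sets in the union agree; the zero coboundary
  ensures that there is at least one.\<close>

lemma HH_map_class:
  assumes f: "f \<in> tuples p B \<rightarrow> carrier A"
    and sub: "B' \<subseteq> B" "M \<subseteq> M'" and "hochschild A B M" "hochschild A B' M'"
  shows "HH_map A B' M' p (HH_class A B M p f) = HH_class A B' M' p (restrict f (tuples p B'))"
proof -
  interpret H: hochschild A B M by fact
  interpret H': hochschild A B' M' by fact
  have sub': "xs \<in> tuples p B" if "xs \<in> tuples p B'" for xs
    using that sub by (auto simp: tuples_def)
  have "HH_class A B' M' p (restrict (\<lambda>xs\<in>tuples p B. k xs \<oplus>\<^bsub>A\<^esub> f xs) (tuples p B')) =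
      HH_class A B' M' p (restrict f (tuples p B'))"
    if k: "k \<in> coboundaries A B M p" for k
  proof -
    have "HH_class A B' M' p (\<lambda>xs\<in>tuples p B'.
        restrict k (tuples p B') xs \<oplus>\<^bsub>A\<^esub> restrict f (tuples p B') xs) =
        HH_class A B' M' p (restrict f (tuples p B'))"
      using f sub' by (intro H'.HH_class_add_coboundary restrict_coboundary[OF k sub assms(4,5)]) auto
    moreover have "restrict (\<lambda>xs\<in>tuples p B. k xs \<oplus>\<^bsub>A\<^esub> f xs) (tuples p B') =
        (\<lambda>xs\<in>tuples p B'. restrict k (tuples p B') xs \<oplus>\<^bsub>A\<^esub> restrict f (tuples p B') xs)"
      using sub' by (auto simp: restrict_def)
    ultimately show ?thesis
      by (simp only:)
  qed
  moreover have "coboundaries A B M p \<noteq> {}"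
    using H.coboundaries_zero by auto
  ultimately show ?thesis
    by (simp add: HH_map_def H.HH_class_eq)
qed

section \<open>The bracket of two-cochains\<close>

text \<open>The bookkeeping for [dg, \<phi>]. The letters p, q, r stand for the four terms of the
  cocycle identity of \<phi> at (g x, y, z), (x, g y, z), (x, y, g z), and s for those of g applied
  to the identity at (x, y, z); a, b, c, d occur on both sides. Each relation is solved for its
  second term, after which only an additive identity remains.\<close>

lemma (in ring) four_cocycle_relations_combine:
  assumes "p1 \<in> carrier R" "p2 \<in> carrier R" "p3 \<in> carrier R" "p4 \<in> carrier R"
    "q1 \<in> carrier R" "q2 \<in> carrier R" "q3 \<in> carrier R" "q4 \<in> carrier R"
    "r1 \<in> carrier R" "r2 \<in> carrier R" "r3 \<in> carrier R" "r4 \<in> carrier R"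
    "s1 \<in> carrier R" "s2 \<in> carrier R" "s3 \<in> carrier R" "s4 \<in> carrier R"
    "a \<in> carrier R" "b \<in> carrier R" "c \<in> carrier R" "d \<in> carrier R"
    and rel: "p1 \<ominus> p2 \<oplus> p3 \<ominus> p4 = \<zero>" "q1 \<ominus> q2 \<oplus> q3 \<ominus> q4 = \<zero>"
      "r1 \<ominus> r2 \<oplus> r3 \<ominus> r4 = \<zero>" "s1 \<ominus> s2 \<oplus> s3 \<ominus> s4 = \<zero>"
  shows "(r4 \<ominus> s4 \<oplus> a) \<ominus> (b \<ominus> s1 \<oplus> p1) \<oplus> (q2 \<ominus> c \<oplus> p2) \<ominus> (r3 \<ominus> d \<oplus> q3) =
    (q1 \<oplus> r1 \<ominus> b) \<ominus> (c \<oplus> r2 \<ominus> s2) \<oplus> (p3 \<oplus> d \<ominus> s3) \<ominus> (p4 \<oplus> q4 \<ominus> a)"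
proof -
  have solve: "p2 = p1 \<oplus> p3 \<ominus> p4"
    if "p1 \<in> carrier R" "p2 \<in> carrier R" "p3 \<in> carrier R" "p4 \<in> carrier R"
      "p1 \<ominus> p2 \<oplus> p3 \<ominus> p4 = \<zero>" for p1 p2 p3 p4
  proof -
    have "p1 \<oplus> p3 \<ominus> p4 = (p1 \<ominus> p2 \<oplus> p3 \<ominus> p4) \<oplus> p2"
      using that(1-4) by algebra
    then show ?thesis
      using that by simp
  qed
  show ?thesis
    unfolding solve[OF assms(1-4) rel(1)] solve[OF assms(5-8) rel(2)]
      solve[OF assms(9-12) rel(3)] solve[OF assms(13-16) rel(4)]
    using assms(1,3,4,5,7,8,9,11,12,13,15-20) by algebra
qed

sublocale complex_algebra \<subseteq> self: hochschild A "carrier A" "carrier A"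
  by unfold_locales auto

context complex_algebra
begin

text \<open>For p = q = 2 the sign in front of the second circle product is -(-1)^9 = 1, so the
  bracket is symmetric and a square bracket is twice a circle product instead of zero.\<close>

lemma gerstenhaber_bracket_2_2:
  assumes f: "f \<in> cochains A (carrier A) (carrier A) 2" and g: "g \<in> cochains A (carrier A) (carrier A) 2"
    and xyz: "x \<in> carrier A" "y \<in> carrier A" "z \<in> carrier A"
  shows "gerstenhaber_bracket A 2 2 f g [x, y, z] =
    f [g [x, y], z] \<ominus> f [x, g [y, z]] \<oplus> g [f [x, y], z] \<ominus> g [x, f [y, z]]"
proof -
  note [simp] = self.cochain2_closed[OF f] self.cochain2_closed[OF g]
  have "circle_product A 2 2 u v [x, y, z] = u [v [x, y], z] \<ominus> u [x, v [y, z]]"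
    if "u \<in> cochains A (carrier A) (carrier A) 2" "v \<in> cochains A (carrier A) (carrier A) 2" for u v
    using xyz self.cochain2_closed[OF that(1)] self.cochain2_closed[OF that(2)]
    by (simp add: circle_product_def tuples_def numeral_2_eq_2 numeral_3_eq_3 lessThan_Suc Pi_def
        minus_eq a_comm)
  from this[OF f g] this[OF g f] show ?thesis
    using xyz by (simp add: gerstenhaber_bracket_def tuples_def minus_eq minus_add a_assoc)
qed

lemma gerstenhaber_bracket_2_2_extensional:
  "gerstenhaber_bracket A 2 2 f g \<in> extensional (tuples 3 (carrier A))"
  by (simp add: gerstenhaber_bracket_def)

lemma gerstenhaber_bracket_2_2_closed:
  assumes f: "f \<in> cochains A (carrier A) (carrier A) 2" and g: "g \<in> cochains A (carrier A) (carrier A) 2"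
  shows "gerstenhaber_bracket A 2 2 f g \<in> tuples 3 (carrier A) \<rightarrow>\<^sub>E carrier A"
  using gerstenhaber_bracket_2_2_extensional gerstenhaber_bracket_2_2[OF f g]
    self.cochain2_closed[OF f] self.cochain2_closed[OF g]
  by (auto simp: PiE_def tuples_three_iff)

text \<open>The bracket is compatible with the differential: if d \<phi> = 0, then [dg, \<phi>] is
  the differential of the bracket of \<phi> with g. This is what makes the bracket of zero classes
  independent of representatives.\<close>

lemma bracket_coboundary_cocycle:
  assumes g: "g \<in> cochains A (carrier A) (carrier A) 1"
    and phi: "\<phi> \<in> cocycles A (carrier A) (carrier A) 2"
  shows "gerstenhaber_bracket A 2 2 (hochschild_d A (carrier A) 1 g) \<phi>
    \<in> coboundaries A (carrier A) (carrier A) 3"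
proof -
  \<comment> \<open>This is [\<phi>, g] for g of degree 1, where all signs of the circle products
    are trivial.\<close>
  define \<psi> where "\<psi> = (\<lambda>xs\<in>tuples 2 (carrier A).
    \<phi> [g [xs ! 0], xs ! 1] \<oplus> \<phi> [xs ! 0, g [xs ! 1]] \<ominus> g [\<phi> [xs ! 0, xs ! 1]])"
  have phi_cochain: "\<phi> \<in> cochains A (carrier A) (carrier A) 2"
    using phi by (simp add: cocycles_def)
  note closed [simp] = self.cochain1_closed[OF g] self.cochain2_closed[OF phi_cochain]
  note lin = self.cochain1_add[OF g] self.cochain1_smult[OF g]
    self.cochain2_add[OF phi_cochain] self.cochain2_smult[OF phi_cochain]
  have g_minus: "g [\<ominus> x] = \<ominus> g [x]" if "x \<in> carrier A" for x
    using that lin(2)[of x "-1"] by simp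
  have phi_minus: "\<phi> [\<ominus> x, y] = \<ominus> \<phi> [x, y]" "\<phi> [x, \<ominus> y] = \<ominus> \<phi> [x, y]"
    if "x \<in> carrier A" "y \<in> carrier A" for x y
    using that lin(5)[of x y "-1"] lin(6)[of x y "-1"] by simp_all
  have psi_cochain: "\<psi> \<in> cochains A (carrier A) (carrier A) 2"
    unfolding \<psi>_def
    by (rule self.cochain2I)
      (simp_all add: lin minus_eq minus_add a_ac smult_r_distr smult_minus)
  have psi: "\<psi> [x, y] = \<phi> [g [x], y] \<oplus> \<phi> [x, g [y]] \<ominus> g [\<phi> [x, y]]"
    if "x \<in> carrier A" "y \<in> carrier A" for x y
    using that by (simp add: \<psi>_def tuples_def)
  have coc: "x \<otimes> \<phi> [y, z] \<ominus> \<phi> [x \<otimes> y, z] \<oplus> \<phi> [x, y \<otimes> z] \<ominus> \<phi> [x, y] \<otimes> z = \<zero>"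
    if "x \<in> carrier A" "y \<in> carrier A" "z \<in> carrier A" for x y z
    using phi that by (simp add: self.cocycle_2_iff[OF phi_cochain])
  have "gerstenhaber_bracket A 2 2 (hochschild_d A (carrier A) 1 g) \<phi> [x, y, z] =
      hochschild_d A (carrier A) 2 \<psi> [x, y, z]"
    if xyz: "x \<in> carrier A" "y \<in> carrier A" "z \<in> carrier A" for x y z
  proof -
    \<comment> \<open>The fourth relation: g applied to the cocycle identity, split by
      linearity.\<close>
    have g_coc: "g [x \<otimes> \<phi> [y, z]] \<ominus> g [\<phi> [x \<otimes> y, z]] \<oplus> g [\<phi> [x, y \<otimes> z]] \<ominus> g [\<phi> [x, y] \<otimes> z] = \<zero>"
    proof -
      have "g [x \<otimes> \<phi> [y, z] \<ominus> \<phi> [x \<otimes> y, z] \<oplus> \<phi> [x, y \<otimes> z] \<ominus> \<phi> [x, y] \<otimes> z] = \<zero>"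
        using coc[OF xyz] lin(2)[of \<zero> 0] by simp
      then show ?thesis
        using xyz by (simp add: lin g_minus minus_eq)
    qed
    have "gerstenhaber_bracket A 2 2 (hochschild_d A (carrier A) 1 g) \<phi> [x, y, z] =
      (\<phi> [x, y] \<otimes> g [z] \<ominus> g [\<phi> [x, y] \<otimes> z] \<oplus> g [\<phi> [x, y]] \<otimes> z) \<ominus>
      (x \<otimes> g [\<phi> [y, z]] \<ominus> g [x \<otimes> \<phi> [y, z]] \<oplus> g [x] \<otimes> \<phi> [y, z]) \<oplus>
      (\<phi> [x \<otimes> g [y], z] \<ominus> \<phi> [g [x \<otimes> y], z] \<oplus> \<phi> [g [x] \<otimes> y, z]) \<ominus>
      (\<phi> [x, y \<otimes> g [z]] \<ominus> \<phi> [x, g [y \<otimes> z]] \<oplus> \<phi> [x, g [y] \<otimes> z])"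
      using xyz
      by (simp add: gerstenhaber_bracket_2_2[OF self.hochschild_d_1_cochain[OF g] phi_cochain]
          self.hochschild_d_1[OF g] lin phi_minus minus_eq del: One_nat_def)
    also have "\<dots> =
      (x \<otimes> \<phi> [g [y], z] \<oplus> x \<otimes> \<phi> [y, g [z]] \<ominus> x \<otimes> g [\<phi> [y, z]]) \<ominus>
      (\<phi> [g [x \<otimes> y], z] \<oplus> \<phi> [x \<otimes> y, g [z]] \<ominus> g [\<phi> [x \<otimes> y, z]]) \<oplus>
      (\<phi> [g [x], y \<otimes> z] \<oplus> \<phi> [x, g [y \<otimes> z]] \<ominus> g [\<phi> [x, y \<otimes> z]]) \<ominus>
      (\<phi> [g [x], y] \<otimes> z \<oplus> \<phi> [x, g [y]] \<otimes> z \<ominus> g [\<phi> [x, y]] \<otimes> z)"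
      using xyz coc[of "g [x]" y z] coc[of x "g [y]" z] coc[of x y "g [z]"] g_coc
      by (intro four_cocycle_relations_combine) simp_all
    also have "\<dots> = hochschild_d A (carrier A) 2 \<psi> [x, y, z]"
      using xyz
      by (simp add: self.hochschild_d_2[OF psi_cochain] psi minus_eq l_distr r_distr l_minus r_minus)
    finally show ?thesis .
  qed
  then have "gerstenhaber_bracket A 2 2 (hochschild_d A (carrier A) 1 g) \<phi> =
      hochschild_d A (carrier A) 2 \<psi>"
    using gerstenhaber_bracket_2_2_extensional self.hochschild_d_closed[OF psi_cochain]
    by (intro extensionalityI[of _ "tuples 3 (carrier A)"])
      (auto simp: tuples_three_iff PiE_def numeral_3_eq_3[symmetric] eval_nat_numeral(3)[of "num.One", symmetric])
  then show ?thesis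
    using psi_cochain by (auto simp: self.coboundaries_3)
qed

text \<open>\<open>HH_bracket\<close> collects the brackets of all pairs of representatives, so the
  zero class involves arbitrary pairs of coboundaries and not just the zero cochain.\<close>

lemma HH_bracket_one:
  "HH_bracket A 2 2 \<one>\<^bsub>HH_alg A 2\<^esub> \<one>\<^bsub>HH_alg A 2\<^esub> = \<one>\<^bsub>HH_alg A 3\<^esub>"
proof -
  have "gerstenhaber_bracket A 2 2 f f' \<in> coboundaries A (carrier A) (carrier A) 3"
    if "f \<in> coboundaries A (carrier A) (carrier A) 2" "f' \<in> coboundaries A (carrier A) (carrier A) 2" for f f'
    using that bracket_coboundary_cocycle self.coboundaries_2_subset
    by (auto simp: self.coboundaries_2)
  then show ?thesis
    using self.coboundaries_zero[of 2]
    by (auto simp: HH_bracket_def self.one_HH self.HH_class_coboundary)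
qed

text \<open>In the alternating sum of x \<psi>(y, z) - \<psi>(x y, z) + \<psi>(x, y z) - \<psi>(x,
  y) z the middle terms cancel in pairs because x, y, z commute. The outer terms pair up along
  cyclic rotations, which are even, into commutators such as x \<psi>(y, z) - \<psi>(y, z) x, and
  \<tau> kills these. The trace property is asked only against x, y, z: the identity component of a
  skew group algebra need not be a trace on the whole algebra.\<close>

lemma coboundary_alternating_trace:
  fixes \<tau> :: "'a \<Rightarrow> 'b::ab_group_add"
  assumes h: "h \<in> coboundaries A (carrier A) (carrier A) 3"
    and xyz: "x \<in> carrier A" "y \<in> carrier A" "z \<in> carrier A"
    and comm: "y \<otimes> x = x \<otimes> y" "z \<otimes> y = y \<otimes> z" "z \<otimes> x = x \<otimes> z"
    and add: "\<And>a b. \<lbrakk>a \<in> carrier A; b \<in> carrier A\<rbrakk> \<Longrightarrow> \<tau> (a \<oplus> b) = \<tau> a + \<tau> b"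
    and trace: "\<And>a b. \<lbrakk>a \<in> {x, y, z}; b \<in> carrier A\<rbrakk> \<Longrightarrow> \<tau> (b \<otimes> a) = \<tau> (a \<otimes> b)"
  shows "\<tau> (h [x, y, z]) - \<tau> (h [x, z, y]) + \<tau> (h [y, z, x]) - \<tau> (h [y, x, z]) +
    \<tau> (h [z, x, y]) - \<tau> (h [z, y, x]) = 0"
proof -
  obtain \<psi> where psi: "\<psi> \<in> cochains A (carrier A) (carrier A) 2" and h: "h = hochschild_d A (carrier A) 2 \<psi>"
    using h by (auto simp: self.coboundaries_3)
  note [simp] = self.cochain2_closed[OF psi]
  have "\<tau> \<zero> = 0"
    using add[of \<zero> \<zero>] by simp
  then have minus: "\<tau> (\<ominus> a) = - \<tau> a" if "a \<in> carrier A" for a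
    using that add[of a "\<ominus> a"] by (simp add: r_neg eq_neg_iff_add_eq_0 add.commute)
  show ?thesis
    using xyz by (simp add: h self.hochschild_d_2[OF psi] minus_eq add minus comm trace)
qed

end

section \<open>Cup products of derivations\<close>

definition derivation :: "(complex, 'a) module \<Rightarrow> ('a \<Rightarrow> 'a) \<Rightarrow> bool" where
  "derivation A D \<longleftrightarrow> D \<in> carrier A \<rightarrow> carrier A \<and>
    (\<forall>x\<in>carrier A. \<forall>y\<in>carrier A. D (x \<oplus>\<^bsub>A\<^esub> y) = D x \<oplus>\<^bsub>A\<^esub> D y) \<and>
    (\<forall>c. \<forall>x\<in>carrier A. D (c \<odot>\<^bsub>A\<^esub> x) = c \<odot>\<^bsub>A\<^esub> D x) \<and>
    (\<forall>x\<in>carrier A. \<forall>y\<in>carrier A. D (x \<otimes>\<^bsub>A\<^esub> y) = x \<otimes>\<^bsub>A\<^esub> D y \<oplus>\<^bsub>A\<^esub> D x \<otimes>\<^bsub>A\<^esub> y)"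

lemma derivationD:
  assumes "derivation A D"
  shows "x \<in> carrier A \<Longrightarrow> D x \<in> carrier A"
    and "\<lbrakk>x \<in> carrier A; y \<in> carrier A\<rbrakk> \<Longrightarrow> D (x \<oplus>\<^bsub>A\<^esub> y) = D x \<oplus>\<^bsub>A\<^esub> D y"
    and "x \<in> carrier A \<Longrightarrow> D (c \<odot>\<^bsub>A\<^esub> x) = c \<odot>\<^bsub>A\<^esub> D x"
    and "\<lbrakk>x \<in> carrier A; y \<in> carrier A\<rbrakk> \<Longrightarrow> D (x \<otimes>\<^bsub>A\<^esub> y) = x \<otimes>\<^bsub>A\<^esub> D y \<oplus>\<^bsub>A\<^esub> D x \<otimes>\<^bsub>A\<^esub> y"
  using assms by (auto simp: derivation_def)

definition cup_product :: "(complex, 'a) module \<Rightarrow> ('a \<Rightarrow> 'a) \<Rightarrow> ('a \<Rightarrow> 'a) \<Rightarrow> 'a list \<Rightarrow> 'a" where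
  "cup_product A D E = (\<lambda>xs\<in>tuples 2 (carrier A). D (xs ! 0) \<otimes>\<^bsub>A\<^esub> E (xs ! 1))"

context complex_algebra
begin

lemma cup_product_cochain:
  assumes "derivation A D" "derivation A E"
  shows "cup_product A D E \<in> cochains A (carrier A) (carrier A) 2"
  unfolding cup_product_def
  by (rule self.cochain2I)
    (simp_all add: derivationD[OF assms(1)] derivationD[OF assms(2)] l_distr r_distr
      smult_mult_l smult_mult_r)

lemma cup_product_apply:
  "\<lbrakk>x \<in> carrier A; y \<in> carrier A\<rbrakk> \<Longrightarrow> cup_product A D E [x, y] = D x \<otimes> E y"
  by (simp add: cup_product_def tuples_def)

text \<open>By the Leibniz rule the differential consists of x D(y) E(z), D(x) y E(z) and D(x) E(y)
  z, each occurring twice with opposite signs and with its factors in the same order, so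
  noncommutativity does no harm.\<close>

lemma cup_product_cocycle:
  assumes "derivation A D" "derivation A E"
  shows "cup_product A D E \<in> cocycles A (carrier A) (carrier A) 2"
proof -
  note [simp] = derivationD[OF assms(1)] derivationD[OF assms(2)]
  have "x \<otimes> (D y \<otimes> E z) \<ominus> (x \<otimes> D y \<oplus> D x \<otimes> y) \<otimes> E z \<oplus> D x \<otimes> (y \<otimes> E z \<oplus> E y \<otimes> z) \<ominus>
      (D x \<otimes> E y) \<otimes> z = \<zero>" if "x \<in> carrier A" "y \<in> carrier A" "z \<in> carrier A" for x y z
  proof -
    have "D x \<in> carrier A" "D y \<in> carrier A" "E y \<in> carrier A" "E z \<in> carrier A"
      using that by simp_all
    then show ?thesis
      using that by algebra
  qed
  then show ?thesis
    by (simp add: self.cocycle_2_iff[OF cup_product_cochain[OF assms]] cup_product_apply)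
qed

end

section \<open>Skew group algebras\<close>

lemma (in abelian_monoid) finsum_swap:
  assumes "finite I" "finite J" "\<And>i j. \<lbrakk>i \<in> I; j \<in> J\<rbrakk> \<Longrightarrow> f i j \<in> carrier G"
  shows "(\<Oplus>i\<in>I. \<Oplus>j\<in>J. f i j) = (\<Oplus>j\<in>J. \<Oplus>i\<in>I. f i j)"
  using assms(1,3)
proof (induction I)
  case empty
  then show ?case
    by simp
next
  case (insert a I)
  have "(\<Oplus>j\<in>J. \<Oplus>i\<in>insert a I. f i j) = (\<Oplus>j\<in>J. f a j \<oplus> (\<Oplus>i\<in>I. f i j))"
    using insert by (intro finsum_cong') (auto simp: Pi_def)
  then show ?case
    using insert by (simp add: Pi_def finsum_addf)
qed

lemma (in complex_algebra) derivation_zero: "derivation A D \<Longrightarrow> D \<zero> = \<zero>"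
  using derivationD(3)[of A D \<zero> 0] derivationD(1)[of A D \<zero>] by simp

lemma (in complex_algebra) derivation_finsum:
  assumes "derivation A D" "f \<in> I \<rightarrow> carrier A"
  shows "D (finsum A f I) = (\<Oplus>i\<in>I. D (f i))"
  using assms(2)
  by (induction I rule: infinite_finite_induct)
    (auto simp: derivation_zero[OF assms(1)] derivationD[OF assms(1)] Pi_def)

locale algebra_action = complex_algebra S + cring S + grp: group G
  for S :: "(complex, 's) module" (structure)
    and G :: "('g, 'm) monoid_scheme" +
  fixes act :: "'g \<Rightarrow> 's \<Rightarrow> 's"
  assumes finite_G: "finite (carrier G)"
    and act_closed: "\<lbrakk>g \<in> carrier G; x \<in> carrier S\<rbrakk> \<Longrightarrow> act g x \<in> carrier S"
    and act_add: "\<lbrakk>g \<in> carrier G; x \<in> carrier S; y \<in> carrier S\<rbrakk> \<Longrightarrow> act g (x \<oplus> y) = act g x \<oplus> act g y"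
    and act_mult: "\<lbrakk>g \<in> carrier G; x \<in> carrier S; y \<in> carrier S\<rbrakk> \<Longrightarrow> act g (x \<otimes> y) = act g x \<otimes> act g y"
    and act_ring_one: "g \<in> carrier G \<Longrightarrow> act g \<one> = \<one>"
    and act_smult: "\<lbrakk>g \<in> carrier G; x \<in> carrier S\<rbrakk> \<Longrightarrow> act g (c \<odot> x) = c \<odot> act g x"
    and act_comp: "\<lbrakk>g \<in> carrier G; h \<in> carrier G; x \<in> carrier S\<rbrakk> \<Longrightarrow>
      act (g \<otimes>\<^bsub>G\<^esub> h) x = act g (act h x)"
    and act_group_one: "x \<in> carrier S \<Longrightarrow> act \<one>\<^bsub>G\<^esub> x = x"
begin

abbreviation "A \<equiv> skew_group_algebra G S act"

lemma act_zero: "g \<in> carrier G \<Longrightarrow> act g \<zero> = \<zero>"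
  using act_smult[of g \<zero> 0] act_closed[of g \<zero>] by simp

lemma act_finsum:
  assumes "g \<in> carrier G" "f \<in> I \<rightarrow> carrier S"
  shows "act g (finsum S f I) = (\<Oplus>i\<in>I. act g (f i))"
  using assms(2)
  by (induction I rule: infinite_finite_induct)
    (auto simp: act_zero act_add act_closed Pi_def assms(1))

lemma skew_sel:
  "carrier A = carrier G \<rightarrow>\<^sub>E carrier S"
  "x \<otimes>\<^bsub>A\<^esub> y = (\<lambda>g\<in>carrier G. \<Oplus>h\<in>carrier G. x h \<otimes> act h (y (inv\<^bsub>G\<^esub> h \<otimes>\<^bsub>G\<^esub> g)))"
  "\<one>\<^bsub>A\<^esub> = (\<lambda>g\<in>carrier G. if g = \<one>\<^bsub>G\<^esub> then \<one> else \<zero>)"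
  "\<zero>\<^bsub>A\<^esub> = (\<lambda>g\<in>carrier G. \<zero>)"
  "x \<oplus>\<^bsub>A\<^esub> y = (\<lambda>g\<in>carrier G. x g \<oplus> y g)"
  "c \<odot>\<^bsub>A\<^esub> x = (\<lambda>g\<in>carrier G. c \<odot> x g)"
  by (simp_all add: skew_group_algebra_def)

lemma PiE_carrier [simp]: "\<lbrakk>x \<in> carrier G \<rightarrow>\<^sub>E carrier S; g \<in> carrier G\<rbrakk> \<Longrightarrow> x g \<in> carrier S"
  by (rule PiE_mem)

lemma skew_apply_closed: "\<lbrakk>x \<in> carrier A; g \<in> carrier G\<rbrakk> \<Longrightarrow> x g \<in> carrier S"
  by (simp add: skew_sel)

lemma skew_eqI:
  assumes "x \<in> carrier A" "y \<in> carrier A" "\<And>g. g \<in> carrier G \<Longrightarrow> x g = y g"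
  shows "x = y"
  using assms by (auto simp: skew_sel intro: PiE_ext)

lemma skew_mult_apply:
  "g \<in> carrier G \<Longrightarrow> (x \<otimes>\<^bsub>A\<^esub> y) g = (\<Oplus>h\<in>carrier G. x h \<otimes> act h (y (inv\<^bsub>G\<^esub> h \<otimes>\<^bsub>G\<^esub> g)))"
  by (simp add: skew_sel)

lemma skew_mult_closed: "\<lbrakk>x \<in> carrier A; y \<in> carrier A\<rbrakk> \<Longrightarrow> x \<otimes>\<^bsub>A\<^esub> y \<in> carrier A"
  by (auto simp: skew_sel act_closed intro!: finsum_closed)

lemma skew_mult_assoc:
  assumes "x \<in> carrier A" "y \<in> carrier A" "z \<in> carrier A"
  shows "x \<otimes>\<^bsub>A\<^esub> y \<otimes>\<^bsub>A\<^esub> z = x \<otimes>\<^bsub>A\<^esub> (y \<otimes>\<^bsub>A\<^esub> z)"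
proof (rule skew_eqI)
  note [simp] = assms[THEN skew_apply_closed] act_closed
  fix g assume g: "g \<in> carrier G"
  \<comment> \<open>Left translation by \<open>k\<close> permutes G. Substituting h = k l turns the
    inner sum over h into the sum that defines the product of \<open>y\<close> and
    \<open>z\<close>.\<close>
  have reindex: "(\<Oplus>h\<in>carrier G. F h) = (\<Oplus>l\<in>carrier G. F (k \<otimes>\<^bsub>G\<^esub> l))"
    if "F \<in> carrier G \<rightarrow> carrier S" "k \<in> carrier G" for F k
    using finsum_reindex[of F "\<lambda>l. k \<otimes>\<^bsub>G\<^esub> l" "carrier G"] that
    by (simp add: grp.surj_const_mult grp.inj_on_cmult)
  have "(x \<otimes>\<^bsub>A\<^esub> y \<otimes>\<^bsub>A\<^esub> z) g =
      (\<Oplus>h\<in>carrier G. (\<Oplus>k\<in>carrier G. x k \<otimes> act k (y (inv\<^bsub>G\<^esub> k \<otimes>\<^bsub>G\<^esub> h))) \<otimes> act h (z (inv\<^bsub>G\<^esub> h \<otimes>\<^bsub>G\<^esub> g)))"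
    using g by (simp add: skew_mult_apply cong: finsum_cong)
  also have "\<dots> = (\<Oplus>h\<in>carrier G. \<Oplus>k\<in>carrier G.
      x k \<otimes> act k (y (inv\<^bsub>G\<^esub> k \<otimes>\<^bsub>G\<^esub> h)) \<otimes> act h (z (inv\<^bsub>G\<^esub> h \<otimes>\<^bsub>G\<^esub> g)))"
    using g finite_G by (intro finsum_cong' finsum_ldistr) auto
  also have "\<dots> = (\<Oplus>k\<in>carrier G. \<Oplus>h\<in>carrier G.
      x k \<otimes> act k (y (inv\<^bsub>G\<^esub> k \<otimes>\<^bsub>G\<^esub> h)) \<otimes> act h (z (inv\<^bsub>G\<^esub> h \<otimes>\<^bsub>G\<^esub> g)))"
    using g finite_G by (intro finsum_swap) auto
  also have "\<dots> = (\<Oplus>k\<in>carrier G. x k \<otimes> act k ((y \<otimes>\<^bsub>A\<^esub> z) (inv\<^bsub>G\<^esub> k \<otimes>\<^bsub>G\<^esub> g)))"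
  proof (intro finsum_cong' refl)
    fix k assume k: "k \<in> carrier G"
    have "(\<Oplus>h\<in>carrier G. x k \<otimes> act k (y (inv\<^bsub>G\<^esub> k \<otimes>\<^bsub>G\<^esub> h)) \<otimes> act h (z (inv\<^bsub>G\<^esub> h \<otimes>\<^bsub>G\<^esub> g))) =
        (\<Oplus>l\<in>carrier G. x k \<otimes> act k (y (inv\<^bsub>G\<^esub> k \<otimes>\<^bsub>G\<^esub> (k \<otimes>\<^bsub>G\<^esub> l))) \<otimes>
          act (k \<otimes>\<^bsub>G\<^esub> l) (z (inv\<^bsub>G\<^esub> (k \<otimes>\<^bsub>G\<^esub> l) \<otimes>\<^bsub>G\<^esub> g)))"
      using g k by (intro reindex) auto
    also have "\<dots> = (\<Oplus>l\<in>carrier G. x k \<otimes> act k (y l \<otimes> act l (z (inv\<^bsub>G\<^esub> l \<otimes>\<^bsub>G\<^esub> (inv\<^bsub>G\<^esub> k \<otimes>\<^bsub>G\<^esub> g)))))"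
      using g k
      by (intro finsum_cong')
        (auto simp: act_comp act_mult m_assoc grp.inv_mult_group grp.m_assoc[symmetric])
    also have "\<dots> = x k \<otimes> act k (\<Oplus>l\<in>carrier G. y l \<otimes> act l (z (inv\<^bsub>G\<^esub> l \<otimes>\<^bsub>G\<^esub> (inv\<^bsub>G\<^esub> k \<otimes>\<^bsub>G\<^esub> g))))"
      using g k finite_G by (subst act_finsum) (auto intro!: finsum_rdistr[symmetric])
    also have "\<dots> = x k \<otimes> act k ((y \<otimes>\<^bsub>A\<^esub> z) (inv\<^bsub>G\<^esub> k \<otimes>\<^bsub>G\<^esub> g))"
      using g k by (simp add: skew_mult_apply)
    finally show "(\<Oplus>h\<in>carrier G. x k \<otimes> act k (y (inv\<^bsub>G\<^esub> k \<otimes>\<^bsub>G\<^esub> h)) \<otimes> act h (z (inv\<^bsub>G\<^esub> h \<otimes>\<^bsub>G\<^esub> g))) =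
        x k \<otimes> act k ((y \<otimes>\<^bsub>A\<^esub> z) (inv\<^bsub>G\<^esub> k \<otimes>\<^bsub>G\<^esub> g))" .
  qed (use g assms in \<open>auto simp: skew_apply_closed skew_mult_closed\<close>)
  also have "\<dots> = (x \<otimes>\<^bsub>A\<^esub> (y \<otimes>\<^bsub>A\<^esub> z)) g"
    using g by (simp add: skew_mult_apply)
  finally show "(x \<otimes>\<^bsub>A\<^esub> y \<otimes>\<^bsub>A\<^esub> z) g = (x \<otimes>\<^bsub>A\<^esub> (y \<otimes>\<^bsub>A\<^esub> z)) g" .
qed (auto intro!: skew_mult_closed assms)

abbreviation "S1 \<equiv> skew_component G S \<one>\<^bsub>G\<^esub>"

lemma component_subset: "skew_component G S g \<subseteq> carrier A"
  by (auto simp: skew_component_def skew_sel)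

lemma mult_component_one_left:
  assumes x: "x \<in> S1" and y: "y \<in> carrier A" and g: "g \<in> carrier G"
  shows "(x \<otimes>\<^bsub>A\<^esub> y) g = x \<one>\<^bsub>G\<^esub> \<otimes> y g"
proof -
  have xA: "x h \<in> carrier S" if "h \<in> carrier G" for h
    using x that component_subset skew_apply_closed by blast
  note [simp] = xA y[THEN skew_apply_closed] act_closed
  have "(x \<otimes>\<^bsub>A\<^esub> y) g = (\<Oplus>h\<in>carrier G. if \<one>\<^bsub>G\<^esub> = h then x h \<otimes> act h (y (inv\<^bsub>G\<^esub> h \<otimes>\<^bsub>G\<^esub> g)) else \<zero>)"
    unfolding skew_mult_apply[OF g] using x g
    by (intro finsum_cong') (auto simp: skew_component_def)
  also have "\<dots> = x \<one>\<^bsub>G\<^esub> \<otimes> y g"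
    using g finite_G by (subst finsum_singleton) (auto simp: act_group_one)
  finally show ?thesis .
qed

text \<open>In the convolution sum only h = g survives. Moving the factor from S past g twists it by
  the action; at the identity the twist disappears, so there left and right multiplication by S
  agree.\<close>

lemma mult_component_one_right:
  assumes x: "x \<in> S1" and y: "y \<in> carrier A" and g: "g \<in> carrier G"
  shows "(y \<otimes>\<^bsub>A\<^esub> x) g = y g \<otimes> act g (x \<one>\<^bsub>G\<^esub>)"
proof -
  have xA: "x h \<in> carrier S" if "h \<in> carrier G" for h
    using x that component_subset skew_apply_closed by blast
  note [simp] = xA y[THEN skew_apply_closed] act_closed
  have "x (inv\<^bsub>G\<^esub> h \<otimes>\<^bsub>G\<^esub> g) = \<zero>" if "h \<in> carrier G" "h \<noteq> g" for h
  proof -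
    have "inv\<^bsub>G\<^esub> h \<otimes>\<^bsub>G\<^esub> g \<noteq> \<one>\<^bsub>G\<^esub>"
      using that g grp.inv_solve_left'[of "\<one>\<^bsub>G\<^esub>" h g] by auto
    then show ?thesis
      using x that g by (simp add: skew_component_def)
  qed
  then have "(y \<otimes>\<^bsub>A\<^esub> x) g = (\<Oplus>h\<in>carrier G. if g = h then y h \<otimes> act h (x (inv\<^bsub>G\<^esub> h \<otimes>\<^bsub>G\<^esub> g)) else \<zero>)"
    unfolding skew_mult_apply[OF g] using g
    by (intro finsum_cong') (auto simp: act_zero)
  also have "\<dots> = y g \<otimes> act g (x \<one>\<^bsub>G\<^esub>)"
    using g finite_G by (subst finsum_singleton) auto
  finally show ?thesis .
qed

lemma skew_one_component: "\<one>\<^bsub>A\<^esub> \<in> S1"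
  by (auto simp: skew_component_def skew_sel)

lemma skew_ring: "ring A"
proof (rule ringI)
  show "abelian_group A"
  proof (rule abelian_groupI)
    fix x assume "x \<in> carrier A"
    then show "\<exists>y\<in>carrier A. y \<oplus>\<^bsub>A\<^esub> x = \<zero>\<^bsub>A\<^esub>"
      by (intro bexI[of _ "\<lambda>g\<in>carrier G. \<ominus> x g"]) (auto simp: skew_sel l_neg intro!: restrict_ext)
  qed (auto simp: skew_sel a_ac intro!: restrict_ext PiE_ext[of _ "carrier G" "\<lambda>_. carrier S"])
  show "Group.monoid A"
  proof (rule monoidI)
    fix x assume x: "x \<in> carrier A"
    show "\<one>\<^bsub>A\<^esub> \<otimes>\<^bsub>A\<^esub> x = x"
      using x skew_one_component component_subset[of "\<one>\<^bsub>G\<^esub>"] skew_apply_closed[OF x]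
      by (intro skew_eqI) (auto simp: mult_component_one_left skew_mult_closed skew_sel(3) subset_iff)
    show "x \<otimes>\<^bsub>A\<^esub> \<one>\<^bsub>A\<^esub> = x"
      using x skew_one_component component_subset[of "\<one>\<^bsub>G\<^esub>"] skew_apply_closed[OF x]
      by (intro skew_eqI)
        (auto simp: mult_component_one_right skew_mult_closed skew_sel(3) subset_iff act_ring_one)
  qed (use skew_one_component component_subset in \<open>auto simp: skew_mult_closed skew_mult_assoc\<close>)
  fix x y z assume xyz: "x \<in> carrier A" "y \<in> carrier A" "z \<in> carrier A"
  note [simp] = xyz[THEN skew_apply_closed] act_closed
  have "(\<Oplus>h\<in>carrier G. (x h \<oplus> y h) \<otimes> act h (z (inv\<^bsub>G\<^esub> h \<otimes>\<^bsub>G\<^esub> g))) =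
      (\<Oplus>h\<in>carrier G. x h \<otimes> act h (z (inv\<^bsub>G\<^esub> h \<otimes>\<^bsub>G\<^esub> g)) \<oplus> y h \<otimes> act h (z (inv\<^bsub>G\<^esub> h \<otimes>\<^bsub>G\<^esub> g)))"
    if "g \<in> carrier G" for g
    using that by (intro finsum_cong') (auto simp: l_distr)
  then show "(x \<oplus>\<^bsub>A\<^esub> y) \<otimes>\<^bsub>A\<^esub> z = x \<otimes>\<^bsub>A\<^esub> z \<oplus>\<^bsub>A\<^esub> y \<otimes>\<^bsub>A\<^esub> z"
    by (auto simp: skew_sel intro!: restrict_ext cong: finsum_cong)
  have "(\<Oplus>h\<in>carrier G. z h \<otimes> act h (x (inv\<^bsub>G\<^esub> h \<otimes>\<^bsub>G\<^esub> g) \<oplus> y (inv\<^bsub>G\<^esub> h \<otimes>\<^bsub>G\<^esub> g))) =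
      (\<Oplus>h\<in>carrier G. z h \<otimes> act h (x (inv\<^bsub>G\<^esub> h \<otimes>\<^bsub>G\<^esub> g)) \<oplus> z h \<otimes> act h (y (inv\<^bsub>G\<^esub> h \<otimes>\<^bsub>G\<^esub> g)))"
    if "g \<in> carrier G" for g
    using that by (intro finsum_cong') (auto simp: r_distr act_add)
  then show "z \<otimes>\<^bsub>A\<^esub> (x \<oplus>\<^bsub>A\<^esub> y) = z \<otimes>\<^bsub>A\<^esub> x \<oplus>\<^bsub>A\<^esub> z \<otimes>\<^bsub>A\<^esub> y"
    by (auto simp: skew_sel intro!: restrict_ext cong: finsum_cong)
qed

lemma skew_algebra: "complex_algebra A"
proof (intro complex_algebra.intro complex_algebra_axioms.intro skew_ring)
  fix x y c assume xy: "x \<in> carrier A" "y \<in> carrier A"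
  note [simp] = xy[THEN skew_apply_closed] act_closed
  have "(\<Oplus>h\<in>carrier G. (c \<odot> x h) \<otimes> act h (y (inv\<^bsub>G\<^esub> h \<otimes>\<^bsub>G\<^esub> g))) =
      c \<odot> (\<Oplus>h\<in>carrier G. x h \<otimes> act h (y (inv\<^bsub>G\<^esub> h \<otimes>\<^bsub>G\<^esub> g)))"
    if "g \<in> carrier G" for g
    using that by (subst smult_finsum) (auto simp: smult_mult_l intro!: finsum_cong')
  then show "(c \<odot>\<^bsub>A\<^esub> x) \<otimes>\<^bsub>A\<^esub> y = c \<odot>\<^bsub>A\<^esub> (x \<otimes>\<^bsub>A\<^esub> y)"
    by (auto simp: skew_sel intro!: restrict_ext cong: finsum_cong)
  have "(\<Oplus>h\<in>carrier G. x h \<otimes> act h (c \<odot> y (inv\<^bsub>G\<^esub> h \<otimes>\<^bsub>G\<^esub> g))) =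
      c \<odot> (\<Oplus>h\<in>carrier G. x h \<otimes> act h (y (inv\<^bsub>G\<^esub> h \<otimes>\<^bsub>G\<^esub> g)))"
    if "g \<in> carrier G" for g
    using that by (subst smult_finsum) (auto simp: smult_mult_r act_smult intro!: finsum_cong')
  then show "x \<otimes>\<^bsub>A\<^esub> (c \<odot>\<^bsub>A\<^esub> y) = c \<odot>\<^bsub>A\<^esub> (x \<otimes>\<^bsub>A\<^esub> y)"
    by (auto simp: skew_sel intro!: restrict_ext cong: finsum_cong)
qed (auto simp: skew_sel smult_l_distr smult_r_distr smult_smult
    intro!: restrict_ext PiE_ext[of _ "carrier G" "\<lambda>_. carrier S"])

end

sublocale algebra_action \<subseteq> skew: complex_algebra A
  by (rule skew_algebra)

section \<open>The summands as bimodules, and the support condition\<close>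

context algebra_action
begin

lemma hochschild_component:
  assumes g: "g \<in> carrier G"
  shows "hochschild A S1 (skew_component G S g)"
proof (unfold_locales)
  have in_A: "x \<in> carrier A" if "x \<in> skew_component G S h" for x h
    using that component_subset by blast
  have S: "x k \<in> carrier S" if "x \<in> skew_component G S h" "k \<in> carrier G" for x h k
    using that in_A skew_apply_closed by blast
  have mem: "x \<in> skew_component G S h \<longleftrightarrow> x \<in> carrier A \<and> (\<forall>k\<in>carrier G - {h}. x k = \<zero>)" for x h
    by (simp add: skew_component_def skew_sel)
  show "S1 \<subseteq> carrier A" "skew_component G S g \<subseteq> carrier A"
    by (rule component_subset)+
  show "\<zero>\<^bsub>A\<^esub> \<in> skew_component G S g"
    by (auto simp: mem skew_sel(4)[symmetric]) (simp add: skew_sel)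
  fix x y
  show "x \<oplus>\<^bsub>A\<^esub> y \<in> skew_component G S g"
    if "x \<in> skew_component G S g" "y \<in> skew_component G S g"
    using that by (auto simp: skew_component_def skew_sel)
  show "x \<oplus>\<^bsub>A\<^esub> y \<in> S1" if "x \<in> S1" "y \<in> S1"
    using that by (auto simp: skew_component_def skew_sel)
  show "c \<odot>\<^bsub>A\<^esub> x \<in> skew_component G S g" if "x \<in> skew_component G S g" for c
    using that by (auto simp: skew_component_def skew_sel)
  show "c \<odot>\<^bsub>A\<^esub> x \<in> S1" if "x \<in> S1" for c
    using that by (auto simp: skew_component_def skew_sel)
  show "x \<otimes>\<^bsub>A\<^esub> y \<in> S1" if "x \<in> S1" "y \<in> S1"
    using that in_A S by (auto simp: mem skew_mult_closed mult_component_one_left)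
  show "x \<otimes>\<^bsub>A\<^esub> y \<in> skew_component G S g" if "x \<in> S1" "y \<in> skew_component G S g"
    using that in_A S by (auto simp: mem skew_mult_closed mult_component_one_left)
  show "x \<otimes>\<^bsub>A\<^esub> y \<in> skew_component G S g" if "x \<in> skew_component G S g" "y \<in> S1"
    using that in_A S act_closed by (auto simp: mem skew_mult_closed mult_component_one_right)
qed

lemma hochschild_restricted: "hochschild A S1 (carrier A)"
proof -
  interpret S1: hochschild A S1 S1
    by (rule hochschild_component) simp
  show ?thesis
    using S1.B_subset by unfold_locales (auto intro: S1.B_add S1.B_smult S1.B_mult)
qed

text \<open>A cocycle preserving \<open>S\<close> is represented by its own restriction in the summand of \<open>\<one>\<close>
  and by zero in all others.\<close>

lemma supported_onI:
  assumes f: "f \<in> cocycles A (carrier A) (carrier A) 2"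
    and f_S1: "\<And>x y. \<lbrakk>x \<in> S1; y \<in> S1\<rbrakk> \<Longrightarrow> f [x, y] \<in> S1"
    and W: "W \<subseteq> carrier G" "\<one>\<^bsub>G\<^esub> \<in> W"
  shows "HH_supported_on G S act 2 W (HH_class A (carrier A) (carrier A) 2 f)"
proof -
  interpret S1A: hochschild A S1 "carrier A"
    by (rule hochschild_restricted)
  interpret S1S1: hochschild A S1 S1
    by (rule hochschild_component) simp
  interpret H: comm_group "HH A S1 (carrier A) 2"
    by (rule S1A.comm_group_HH_2)
  define r where "r = restrict f (tuples 2 S1)"
  define c where "c g = (if g = \<one>\<^bsub>G\<^esub> then HH_class A S1 S1 2 r
    else HH_class A S1 (skew_component G S g) 2 (zero_cochain A S1 2))" for g
  have f_cochain: "f \<in> cochains A (carrier A) (carrier A) 2"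
    using f by (simp add: cocycles_def)
  have rA: "r \<in> cochains A S1 (carrier A) 2"
    unfolding r_def using restrict_cochain[OF f_cochain S1A.B_subset subset_refl] hochschild_restricted .
  have r_apply: "r [x, y] = f [x, y]" if "x \<in> S1" "y \<in> S1" for x y
    using that by (simp add: r_def tuples_def)
  have rM: "r \<in> tuples 2 S1 \<rightarrow>\<^sub>E S1"
    using f_S1 by (auto simp: r_def tuples_two_iff)
  then have r1: "r \<in> cochains A S1 S1 2"
    using rA by (simp add: cochains_def)
  \<comment> \<open>The cocycle equations are pointwise and survive restriction. Both coefficient
    modules are needed: \<open>S1\<close> for the class chosen in the summand of the identity, the
    whole algebra for the target of \<open>HH_map\<close>.\<close>
  have r_cocycle: "r \<in> cocycles A S1 S1 2" "r \<in> cocycles A S1 (carrier A) 2"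
    using f skew.self.cocycle_2_iff[OF f_cochain] S1A.B_carrier
    by (simp_all add: S1S1.cocycle_2_iff[OF r1] S1A.cocycle_2_iff[OF rA] r_apply S1A.B_mult)
  have map_c: "HH_map A S1 (carrier A) 2 (c g) =
      (if g = \<one>\<^bsub>G\<^esub> then HH_class A S1 (carrier A) 2 r else \<one>\<^bsub>HH A S1 (carrier A) 2\<^esub>)"
    if "g \<in> carrier G" for g
  proof (cases "g = \<one>\<^bsub>G\<^esub>")
    case True
    have "restrict r (tuples 2 S1) = r"
      using rM by (simp add: PiE_restrict)
    then show ?thesis
      using True rM component_subset[of "\<one>\<^bsub>G\<^esub>"]
        HH_map_class[OF _ subset_refl _ S1S1.hochschild_axioms hochschild_restricted, of r 2]
      by (auto simp: c_def PiE_iff Pi_iff)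
  next
    case False
    have "restrict (zero_cochain A S1 2) (tuples 2 S1) = zero_cochain A S1 2"
      by (simp add: zero_cochain_def)
    then show ?thesis
      using False component_subset[of g]
        HH_map_class[OF _ subset_refl _ hochschild_component[OF that] hochschild_restricted,
          of "zero_cochain A S1 2" 2] S1A.HH_class_coboundary[OF S1A.coboundaries_zero]
      by (simp add: c_def S1A.one_HH) (simp add: zero_cochain_def)
  qed
  have "HH_map A S1 (carrier A) 2 (HH_class A (carrier A) (carrier A) 2 f) = HH_class A S1 (carrier A) 2 r"
    unfolding r_def
    using cochains_PiE[OF f_cochain] S1A.B_subset
    by (intro HH_map_class hochschild_restricted skew.self.hochschild_axioms) (auto simp: PiE_iff)
  \<comment> \<open>A product with a single nontrivial factor, which is present because
    \<open>W\<close> contains the identity.\<close>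
  also have "\<dots> = (\<Otimes>\<^bsub>HH A S1 (carrier A) 2\<^esub>g\<in>W.
      if \<one>\<^bsub>G\<^esub> = g then HH_class A S1 (carrier A) 2 r else \<one>\<^bsub>HH A S1 (carrier A) 2\<^esub>)"
    using W finite_subset[OF W(1) finite_G] S1A.HH_class_closed[OF r_cocycle(2)]
    by (subst H.finprod_singleton) auto
  also have "\<dots> = (\<Otimes>\<^bsub>HH A S1 (carrier A) 2\<^esub>g\<in>W. HH_map A S1 (carrier A) 2 (c g))"
    using W map_c S1A.HH_class_closed[OF r_cocycle(2)]
    by (intro H.finprod_cong') (auto simp: subset_iff)
  finally have "HH_map A S1 (carrier A) 2 (HH_class A (carrier A) (carrier A) 2 f) =
      (\<Otimes>\<^bsub>HH A S1 (carrier A) 2\<^esub>g\<in>W. HH_map A S1 (carrier A) 2 (c g))" .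
  moreover have "c g \<in> carrier (HH A S1 (skew_component G S g) 2)" if "g \<in> W" for g
  proof -
    interpret Sg: hochschild A S1 "skew_component G S g"
      using that W by (intro hochschild_component) auto
    show ?thesis
      using S1S1.HH_class_closed[OF r_cocycle(1)] Sg.HH_class_closed[OF Sg.zero_cocycle]
      by (simp add: c_def)
  qed
  ultimately show ?thesis
    by (auto simp: HH_supported_on_def Let_def)
qed

section \<open>Lifted derivations and a criterion for a nonzero square bracket\<close>

definition lift :: "('s \<Rightarrow> 's) \<Rightarrow> ('g \<Rightarrow> 's) \<Rightarrow> 'g \<Rightarrow> 's" where
  "lift D x = (\<lambda>g\<in>carrier G. D (x g))"

definition emb :: "'s \<Rightarrow> 'g \<Rightarrow> 's" where
  "emb s = (\<lambda>g\<in>carrier G. if g = \<one>\<^bsub>G\<^esub> then s else \<zero>)"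

text \<open>Coefficients of a product contain factors \<open>act h (y k)\<close>. Equivariance moves
  \<open>D\<close> inside the action, and the Leibniz rule of S then yields exactly the coefficients
  of the two products on the right.\<close>

lemma derivation_lift:
  assumes D: "derivation S D"
    and equiv: "\<And>g x. \<lbrakk>g \<in> carrier G; x \<in> carrier S\<rbrakk> \<Longrightarrow> D (act g x) = act g (D x)"
  shows "derivation A (lift D)"
  unfolding derivation_def
proof (intro conjI ballI allI)
  note D' = derivationD[OF D]
  show "lift D \<in> carrier A \<rightarrow> carrier A"
    by (auto simp: lift_def skew_sel D')
  fix x y c assume xy: "x \<in> carrier A" "y \<in> carrier A"
  note [simp] = xy[THEN skew_apply_closed] act_closed D'(1)
  have "D (\<Oplus>h\<in>carrier G. x h \<otimes> act h (y (inv\<^bsub>G\<^esub> h \<otimes>\<^bsub>G\<^esub> g))) =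
      (\<Oplus>h\<in>carrier G. x h \<otimes> act h (D (y (inv\<^bsub>G\<^esub> h \<otimes>\<^bsub>G\<^esub> g)))) \<oplus>
      (\<Oplus>h\<in>carrier G. D (x h) \<otimes> act h (y (inv\<^bsub>G\<^esub> h \<otimes>\<^bsub>G\<^esub> g)))" if g: "g \<in> carrier G" for g
  proof -
    have "D (\<Oplus>h\<in>carrier G. x h \<otimes> act h (y (inv\<^bsub>G\<^esub> h \<otimes>\<^bsub>G\<^esub> g))) =
        (\<Oplus>h\<in>carrier G. D (x h \<otimes> act h (y (inv\<^bsub>G\<^esub> h \<otimes>\<^bsub>G\<^esub> g))))"
      using g by (intro derivation_finsum[OF D]) auto
    also have "\<dots> = (\<Oplus>h\<in>carrier G. x h \<otimes> act h (D (y (inv\<^bsub>G\<^esub> h \<otimes>\<^bsub>G\<^esub> g))) \<oplus>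
        D (x h) \<otimes> act h (y (inv\<^bsub>G\<^esub> h \<otimes>\<^bsub>G\<^esub> g)))"
      using g by (intro finsum_cong') (auto simp: D'(4) equiv)
    also have "\<dots> = (\<Oplus>h\<in>carrier G. x h \<otimes> act h (D (y (inv\<^bsub>G\<^esub> h \<otimes>\<^bsub>G\<^esub> g)))) \<oplus>
      (\<Oplus>h\<in>carrier G. D (x h) \<otimes> act h (y (inv\<^bsub>G\<^esub> h \<otimes>\<^bsub>G\<^esub> g)))"
      using g by (intro finsum_addf) auto
    finally show ?thesis .
  qed
  then show "lift D (x \<otimes>\<^bsub>A\<^esub> y) = x \<otimes>\<^bsub>A\<^esub> lift D y \<oplus>\<^bsub>A\<^esub> lift D x \<otimes>\<^bsub>A\<^esub> y"
    by (auto simp: skew_sel lift_def intro!: restrict_ext cong: finsum_cong)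
  show "lift D (x \<oplus>\<^bsub>A\<^esub> y) = lift D x \<oplus>\<^bsub>A\<^esub> lift D y" "lift D (c \<odot>\<^bsub>A\<^esub> x) = c \<odot>\<^bsub>A\<^esub> lift D x"
    by (auto simp: skew_sel lift_def D' intro!: restrict_ext)
qed

lemma emb_component: "s \<in> carrier S \<Longrightarrow> emb s \<in> S1"
  by (auto simp: emb_def skew_component_def)

lemma emb_mult:
  assumes "s \<in> carrier S" "t \<in> carrier S"
  shows "emb s \<otimes>\<^bsub>A\<^esub> emb t = emb (s \<otimes> t)"
proof (rule skew_eqI)
  have emb_A: "emb r \<in> carrier A" if "r \<in> carrier S" for r
    using emb_component[OF that] component_subset by blast
  then show "emb s \<otimes>\<^bsub>A\<^esub> emb t \<in> carrier A" "emb (s \<otimes> t) \<in> carrier A"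
    using assms by (simp_all add: skew_mult_closed)
  fix g assume "g \<in> carrier G"
  then show "(emb s \<otimes>\<^bsub>A\<^esub> emb t) g = emb (s \<otimes> t) g"
    using assms mult_component_one_left[OF emb_component emb_A, of s t g]
    by (simp add: emb_def)
qed

lemma lift_emb: "derivation S D \<Longrightarrow> lift D (emb s) = emb (D s)"
  by (auto simp: lift_def emb_def derivation_zero intro!: restrict_ext)

lemma lift_component:
  "\<lbrakk>derivation S D; x \<in> S1\<rbrakk> \<Longrightarrow> lift D x \<in> S1"
  by (auto simp: lift_def skew_component_def derivation_zero derivationD(1))

text \<open>Under the vanishing assumptions only the orders (x, z, y) and (z, x, y) contribute to
  the alternating sum, and they give twice the two sides of \<open>T_neq\<close> with opposite
  signs. The additive functional \<open>T\<close> reduces the comparison in S to one of complex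
  numbers.\<close>

lemma square_bracket_nonzero:
  fixes T :: "'s \<Rightarrow> complex"
  assumes E: "derivation S E" "\<And>g x. \<lbrakk>g \<in> carrier G; x \<in> carrier S\<rbrakk> \<Longrightarrow> E (act g x) = act g (E x)"
    and D: "derivation S D" "\<And>g x. \<lbrakk>g \<in> carrier G; x \<in> carrier S\<rbrakk> \<Longrightarrow> D (act g x) = act g (D x)"
    and xyz: "x \<in> carrier S" "y \<in> carrier S" "z \<in> carrier S"
    and vanish: "E y = \<zero>" "D x = \<zero>" "D z = \<zero>"
    and T_add: "\<And>a b. \<lbrakk>a \<in> carrier S; b \<in> carrier S\<rbrakk> \<Longrightarrow> T (a \<oplus> b) = T a + T b"
    and T_neq: "T (E x \<otimes> D (E z \<otimes> D y)) \<noteq> T (E z \<otimes> D (E x \<otimes> D y))"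
  shows "gerstenhaber_bracket A 2 2 (cup_product A (lift E) (lift D)) (cup_product A (lift E) (lift D))
    \<notin> coboundaries A (carrier A) (carrier A) 3"
proof
  let ?f = "cup_product A (lift E) (lift D)"
  let ?h = "gerstenhaber_bracket A 2 2 ?f ?f"
  assume h: "?h \<in> coboundaries A (carrier A) (carrier A) 3"
  note der = derivation_lift[OF E] derivation_lift[OF D]
  note f = skew.cup_product_cochain[OF der]
  note [simp] = derivationD(1)[OF E(1)] derivationD(1)[OF D(1)]
  have emb_A [simp]: "emb s \<in> carrier A" if "s \<in> carrier S" for s
    using emb_component[OF that] component_subset by blast
  have T_zero: "T \<zero> = 0"
    using T_add[of \<zero> \<zero>] by simp
  have T_minus: "T (\<ominus> a) = - T a" if "a \<in> carrier S" for a
    using that T_add[of a "\<ominus> a"] T_zero by (simp add: r_neg eq_neg_iff_add_eq_0 add.commute)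
  have f_emb: "?f [emb a, emb b] = emb (E a \<otimes> D b)" if "a \<in> carrier S" "b \<in> carrier S" for a b
    using that by (simp add: skew.cup_product_apply lift_emb E D emb_mult)
  have minus_apply: "(a \<ominus>\<^bsub>A\<^esub> b) \<one>\<^bsub>G\<^esub> = a \<one>\<^bsub>G\<^esub> \<ominus> b \<one>\<^bsub>G\<^esub>" if "a \<in> carrier A" "b \<in> carrier A" for a b
  proof -
    \<comment> \<open>Negation in the skew group algebra is abstract, whereas scalar multiplication
      is componentwise by definition; hence the detour through the scalar -1.\<close>
    have "a \<ominus>\<^bsub>A\<^esub> b = a \<oplus>\<^bsub>A\<^esub> -1 \<odot>\<^bsub>A\<^esub> b"
      using that by (simp add: skew.minus_eq)
    then show ?thesis
      using that skew_apply_closed by (simp add: skew_sel minus_eq)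
  qed
  have add_apply: "(a \<oplus>\<^bsub>A\<^esub> b) \<one>\<^bsub>G\<^esub> = a \<one>\<^bsub>G\<^esub> \<oplus> b \<one>\<^bsub>G\<^esub>" for a b
    by (simp add: skew_sel)
  have emb_apply: "emb s \<one>\<^bsub>G\<^esub> = s" for s
    by (simp add: emb_def)
  \<comment> \<open>The factor 2 appears because both arguments of the bracket are the same cochain
    and the two circle products are added.\<close>
  have h_emb: "T (?h [emb a, emb b, emb c] \<one>\<^bsub>G\<^esub>) =
      2 * (T (E (E a \<otimes> D b) \<otimes> D c) - T (E a \<otimes> D (E b \<otimes> D c)))"
    if "a \<in> carrier S" "b \<in> carrier S" "c \<in> carrier S" for a b c
    using that
    by (simp add: skew.gerstenhaber_bracket_2_2[OF f f] f_emb minus_apply add_apply emb_apply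
        T_add T_minus minus_eq)
  have "T (?h [emb x, emb y, emb z] \<one>\<^bsub>G\<^esub>) - T (?h [emb x, emb z, emb y] \<one>\<^bsub>G\<^esub>) +
      T (?h [emb y, emb z, emb x] \<one>\<^bsub>G\<^esub>) - T (?h [emb y, emb x, emb z] \<one>\<^bsub>G\<^esub>) +
      T (?h [emb z, emb x, emb y] \<one>\<^bsub>G\<^esub>) - T (?h [emb z, emb y, emb x] \<one>\<^bsub>G\<^esub>) = 0"
  \<comment> \<open>The functional is \<open>T\<close> of the identity component. The three embedded
    elements lie in \<open>S1\<close>, so multiplying by them on either side acts on that component
    as multiplication in the commutative S.\<close>
  proof (rule skew.coboundary_alternating_trace[OF h, where \<tau> = "\<lambda>a. T (a \<one>\<^bsub>G\<^esub>)"])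
    fix a b assume "a \<in> {emb x, emb y, emb z}" and b: "b \<in> carrier A"
    then have "a \<in> S1"
      using xyz emb_component by auto
    moreover from this have "a \<one>\<^bsub>G\<^esub> \<in> carrier S"
      using component_subset skew_apply_closed by blast
    ultimately show "T ((b \<otimes>\<^bsub>A\<^esub> a) \<one>\<^bsub>G\<^esub>) = T ((a \<otimes>\<^bsub>A\<^esub> b) \<one>\<^bsub>G\<^esub>)"
      using skew_apply_closed[OF b, of "\<one>\<^bsub>G\<^esub>"]
      by (simp add: mult_component_one_left mult_component_one_right b act_group_one m_comm)
  qed (simp_all add: xyz emb_mult m_comm add_apply T_add skew_apply_closed)
  then show False
    using T_neq xyz
    by (simp add: h_emb vanish derivation_zero[OF E(1)] derivation_zero[OF D(1)] T_zero)
qed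

end

section \<open>Polynomials in the vectors of a space\<close>

lemma poly_mapping_single_induct [case_names zero single add]:
  assumes "P 0" "\<And>a b. P (Poly_Mapping.single a b)" "\<And>p q. \<lbrakk>P p; P q\<rbrakk> \<Longrightarrow> P (p + q)"
  shows "P (p :: 'a \<Rightarrow>\<^sub>0 'b::monoid_add)"
proof (induction p rule: update_induct)
  case const
  show ?case
    by (rule assms)
next
  case (update p a b)
  \<comment> \<open>The induction inserts a key outside the support of \<open>p\<close>, so updating
    amounts to adding a single term.\<close>
  then have "Poly_Mapping.update a b p = Poly_Mapping.single a b + p"
    by (intro poly_mapping_eqI) (auto simp: lookup_add lookup_update lookup_single when_def in_keys_iff)
  then show ?case
    using update assms by simp
qed

lemma vpoly_const_simps:
  "vpoly_const 0 = 0" "vpoly_const 1 = 1"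
  "vpoly_const (a + b) = vpoly_const a + vpoly_const b"
  "vpoly_const (a * b) = vpoly_const a * vpoly_const b"
  by (simp_all add: vpoly_const_def single_add mult_single)

lemma vpoly_const_power: "vpoly_const (a ^ n) = vpoly_const a ^ n"
  by (induction n) (simp_all add: vpoly_const_simps)

lemma vpoly_var_power: "vpoly_var v ^ n = Poly_Mapping.single (Poly_Mapping.single v n) 1"
  by (induction n) (simp_all add: vpoly_var_def mult_single single_add[symmetric])

text \<open>Induction along ring generators instead of monomials. It suits congruences modulo
  \<open>sym_ideal\<close>, which are stable under sums and products.\<close>

lemma vpoly_induct [case_names const var add mult]:
  assumes const: "\<And>c. P (vpoly_const c)"
    and var: "\<And>v. P (vpoly_var v)"
    and add: "\<And>p q. \<lbrakk>P p; P q\<rbrakk> \<Longrightarrow> P (p + q)"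
    and mult: "\<And>p q. \<lbrakk>P p; P q\<rbrakk> \<Longrightarrow> P (p * q)"
  shows "P (p :: 'v vpoly)"
proof (induction p rule: poly_mapping_single_induct)
  case zero
  show ?case
    using const[of 0] by (simp add: vpoly_const_simps)
next
  case (single m c)
  have "P (Poly_Mapping.single m 1)" for m :: "'v \<Rightarrow>\<^sub>0 nat"
  proof (induction m rule: poly_mapping_single_induct)
    case zero
    show ?case
      using const[of 1] by (simp add: vpoly_const_def)
  next
    case (single v n)
    have "P (vpoly_var v ^ n)"
      using const[of 1] var mult by (induction n) (auto simp: vpoly_const_simps)
    then show ?case
      by (simp add: vpoly_var_power)
  next
    case (add m n)
    then show ?case
      using mult by (fastforce simp: mult_single)
  qed
  then show ?case
    using mult[OF const[of c], of "Poly_Mapping.single m 1"]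
    by (simp add: vpoly_const_def mult_single)
qed (rule add)

definition monomial_eval :: "('v \<Rightarrow> 'r::comm_ring_1) \<Rightarrow> ('v \<Rightarrow>\<^sub>0 nat) \<Rightarrow> 'r" where
  "monomial_eval \<phi> m = (\<Prod>v\<in>Poly_Mapping.keys m. \<phi> v ^ Poly_Mapping.lookup m v)"

text \<open>The embedding \<kappa> of the scalars is a parameter because there are two targets: the
  polynomial ring itself, for renamings and normal forms, and the complex numbers, for evaluation at
  a point.\<close>

definition vpoly_eval :: "(complex \<Rightarrow> 'r::comm_ring_1) \<Rightarrow> ('v \<Rightarrow> 'r) \<Rightarrow> 'v vpoly \<Rightarrow> 'r" where
  "vpoly_eval \<kappa> \<phi> p =
    (\<Sum>m\<in>Poly_Mapping.keys p. \<kappa> (Poly_Mapping.lookup p m) * monomial_eval \<phi> m)"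

lemma monomial_eval_superset:
  assumes "finite V" "Poly_Mapping.keys m \<subseteq> V"
  shows "monomial_eval \<phi> m = (\<Prod>v\<in>V. \<phi> v ^ Poly_Mapping.lookup m v)"
  unfolding monomial_eval_def using assms
  by (intro prod.mono_neutral_left) (auto simp: in_keys_iff)

lemma monomial_eval_add: "monomial_eval \<phi> (m + n) = monomial_eval \<phi> m * monomial_eval \<phi> n"
  using keys_add[of m n]
  by (simp add: monomial_eval_superset[of "Poly_Mapping.keys m \<union> Poly_Mapping.keys n"]
      lookup_add power_add prod.distrib)

locale scalar_hom =
  fixes \<kappa> :: "complex \<Rightarrow> 'r::comm_ring_1"
  assumes hom: "\<kappa> 0 = 0" "\<kappa> 1 = 1" "\<kappa> (a + b) = \<kappa> a + \<kappa> b" "\<kappa> (a * b) = \<kappa> a * \<kappa> b"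
begin

lemma vpoly_eval_add: "vpoly_eval \<kappa> \<phi> (p + q) = vpoly_eval \<kappa> \<phi> p + vpoly_eval \<kappa> \<phi> q"
  unfolding vpoly_eval_def by (rule setsum_keys_plus_distrib) (simp_all add: hom distrib_right)

lemma vpoly_eval_single: "vpoly_eval \<kappa> \<phi> (Poly_Mapping.single m c) = \<kappa> c * monomial_eval \<phi> m"
  by (simp add: vpoly_eval_def hom)

lemma vpoly_eval_zero: "vpoly_eval \<kappa> \<phi> 0 = 0"
  by (simp add: vpoly_eval_def)

lemma vpoly_eval_mult: "vpoly_eval \<kappa> \<phi> (p * q) = vpoly_eval \<kappa> \<phi> p * vpoly_eval \<kappa> \<phi> q"
proof (induction p rule: poly_mapping_single_induct)
  case (single m c)
  show ?case
    by (induction q rule: poly_mapping_single_induct)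
      (simp_all add: vpoly_eval_zero vpoly_eval_add vpoly_eval_single mult_single monomial_eval_add
        hom algebra_simps)
qed (simp_all add: vpoly_eval_zero vpoly_eval_add distrib_right)

lemma vpoly_eval_const: "vpoly_eval \<kappa> \<phi> (vpoly_const c) = \<kappa> c"
  by (simp add: vpoly_const_def vpoly_eval_single monomial_eval_def)

lemma vpoly_eval_var: "vpoly_eval \<kappa> \<phi> (vpoly_var v) = \<phi> v"
  by (simp add: vpoly_var_def vpoly_eval_single monomial_eval_def hom)

lemma vpoly_eval_uminus: "vpoly_eval \<kappa> \<phi> (- p) = - vpoly_eval \<kappa> \<phi> p"
  using vpoly_eval_add[of \<phi> p "- p"] by (simp add: vpoly_eval_zero eq_neg_iff_add_eq_0 add.commute)

lemma vpoly_eval_diff: "vpoly_eval \<kappa> \<phi> (p - q) = vpoly_eval \<kappa> \<phi> p - vpoly_eval \<kappa> \<phi> q"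
  using vpoly_eval_add[of \<phi> p "- q"] by (simp add: vpoly_eval_uminus)

lemma vpoly_eval_one: "vpoly_eval \<kappa> \<phi> 1 = 1"
  using vpoly_eval_const[of \<phi> 1] by (simp add: hom vpoly_const_simps)

lemma vpoly_eval_power: "vpoly_eval \<kappa> \<phi> (p ^ n) = vpoly_eval \<kappa> \<phi> p ^ n"
  by (induction n) (simp_all add: vpoly_eval_one vpoly_eval_mult)

lemma vpoly_eval_of_nat: "vpoly_eval \<kappa> \<phi> (of_nat n) = of_nat n"
  by (induction n) (simp_all add: vpoly_eval_zero vpoly_eval_one vpoly_eval_add)

lemma vpoly_eval_sum: "vpoly_eval \<kappa> \<phi> (\<Sum>i\<in>I. f i) = (\<Sum>i\<in>I. vpoly_eval \<kappa> \<phi> (f i))"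
  by (induction I rule: infinite_finite_induct) (simp_all add: vpoly_eval_zero vpoly_eval_add)

lemmas vpoly_eval_simps = vpoly_eval_zero vpoly_eval_one vpoly_eval_const vpoly_eval_var
  vpoly_eval_add vpoly_eval_mult vpoly_eval_uminus vpoly_eval_diff vpoly_eval_power
  vpoly_eval_of_nat vpoly_eval_sum

end

interpretation const_hom: scalar_hom vpoly_const
  by unfold_locales (simp_all add: vpoly_const_simps)

interpretation id_hom: scalar_hom "\<lambda>c :: complex. c"
  by unfold_locales simp_all

text \<open>Replaces the explicit sum over monomials by a substitution, so that the homomorphism
  laws come for free.\<close>

lemma vpoly_rename_eq: "vpoly_rename f p = vpoly_eval vpoly_const (\<lambda>v. vpoly_var (f v)) p"
proof -
  have "(\<Prod>v\<in>V. Poly_Mapping.single (Poly_Mapping.single (f v) (k v :: nat)) 1) =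
      Poly_Mapping.single (\<Sum>v\<in>V. Poly_Mapping.single (f v) (k v)) (1::complex)" for V k
    by (induction V rule: infinite_finite_induct) (simp_all add: mult_single)
  then show ?thesis
    by (simp add: vpoly_rename_def vpoly_eval_def monomial_eval_def vpoly_var_power
        vpoly_const_def mult_single)
qed

text \<open>The derivation \<open>x\<^sub>b \<partial>/\<partial>x\<^sub>b\<close>: it multiplies a monomial by its degree in \<open>b\<close>.\<close>

definition vpoly_log_deriv :: "'v \<Rightarrow> 'v vpoly \<Rightarrow> 'v vpoly" where
  "vpoly_log_deriv b p = (\<Sum>m\<in>Poly_Mapping.keys p.
     Poly_Mapping.single m (of_nat (Poly_Mapping.lookup m b) * Poly_Mapping.lookup p m))"

lemma vpoly_log_deriv_add:
  "vpoly_log_deriv b (p + q) = vpoly_log_deriv b p + vpoly_log_deriv b q"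
  unfolding vpoly_log_deriv_def
  by (rule setsum_keys_plus_distrib) (simp_all add: single_add distrib_left)

lemma vpoly_log_deriv_single:
  "vpoly_log_deriv b (Poly_Mapping.single m c) =
    Poly_Mapping.single m (of_nat (Poly_Mapping.lookup m b) * c)"
  by (simp add: vpoly_log_deriv_def)

lemma vpoly_log_deriv_zero: "vpoly_log_deriv b 0 = 0"
  by (simp add: vpoly_log_deriv_def)

lemma vpoly_log_deriv_uminus: "vpoly_log_deriv b (- p) = - vpoly_log_deriv b p"
  using vpoly_log_deriv_add[of b p "- p"]
  by (simp add: vpoly_log_deriv_zero eq_neg_iff_add_eq_0 add.commute)

lemma vpoly_log_deriv_const: "vpoly_log_deriv b (vpoly_const c) = 0"
  by (simp add: vpoly_const_def vpoly_log_deriv_single)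

lemma vpoly_log_deriv_var: "vpoly_log_deriv b (vpoly_var v) = (if v = b then vpoly_var v else 0)"
  by (simp add: vpoly_var_def vpoly_log_deriv_single lookup_single)

lemma vpoly_log_deriv_mult:
  "vpoly_log_deriv b (p * q) = p * vpoly_log_deriv b q + vpoly_log_deriv b p * q"
proof (induction p rule: poly_mapping_single_induct)
  case (single m c)
  show ?case
    by (induction q rule: poly_mapping_single_induct)
      (simp_all add: vpoly_log_deriv_zero vpoly_log_deriv_add vpoly_log_deriv_single mult_single
        lookup_add distrib_left distrib_right ac_simps single_add[symmetric])
qed (simp_all add: vpoly_log_deriv_zero vpoly_log_deriv_add distrib_right)

lemma vpoly_log_deriv_power:
  "vpoly_log_deriv b (vpoly_var b ^ n) = of_nat n * vpoly_var b ^ n"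
  by (simp add: vpoly_var_power vpoly_log_deriv_single lookup_single mult_single
      single_of_nat[symmetric] del: single_of_nat)

lemma vpoly_log_deriv_sum: "vpoly_log_deriv b (\<Sum>i\<in>I. f i) = (\<Sum>i\<in>I. vpoly_log_deriv b (f i))"
  by (induction I rule: infinite_finite_induct)
    (simp_all add: vpoly_log_deriv_zero vpoly_log_deriv_add)

section \<open>The symmetric algebra\<close>

lemma vpoly_ring_sel [simp]:
  "carrier vpoly_ring = UNIV" "mult vpoly_ring = (*)" "one vpoly_ring = 1" "zero vpoly_ring = 0"
  "add vpoly_ring = (+)"
  by (simp_all add: vpoly_ring_def)

lemma cring_vpoly_ring: "cring (vpoly_ring :: 'v vpoly ring)"
proof (rule cringI)
  show "abelian_group (vpoly_ring :: 'v vpoly ring)"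
    by (rule abelian_groupI) (auto simp: ac_simps intro: exI[of _ "- x" for x])
  show "Group.comm_monoid (vpoly_ring :: 'v vpoly ring)"
    by (rule comm_monoidI) (simp_all add: ac_simps)
qed (simp add: distrib_right)

abbreviation sym_class :: "(complex \<Rightarrow> 'v::ab_group_add \<Rightarrow> 'v) \<Rightarrow> 'v vpoly \<Rightarrow> 'v vpoly set" where
  "sym_class scale p \<equiv> sym_ideal scale +>\<^bsub>vpoly_ring\<^esub> p"

lemma ideal_sym_ideal: "ideal (sym_ideal scale) vpoly_ring"
  unfolding sym_ideal_def
  by (rule ring.genideal_ideal[OF cring.axioms(1)[OF cring_vpoly_ring]]) simp

lemma sym_ideal_closed:
  "0 \<in> sym_ideal scale"
  "\<lbrakk>p \<in> sym_ideal scale; q \<in> sym_ideal scale\<rbrakk> \<Longrightarrow> p + q \<in> sym_ideal scale"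
  "p \<in> sym_ideal scale \<Longrightarrow> q * p \<in> sym_ideal scale"
  using additive_subgroup.zero_closed[OF ideal.axioms(1)[OF ideal_sym_ideal[of scale]]]
    additive_subgroup.a_closed[OF ideal.axioms(1)[OF ideal_sym_ideal[of scale]], of p q]
    ideal.I_l_closed[OF ideal_sym_ideal[of scale], of p q]
  by simp_all

lemma sym_ideal_generators:
  "vpoly_var (v + w) - vpoly_var v - vpoly_var w \<in> sym_ideal scale"
  "vpoly_var (scale c v) - vpoly_const c * vpoly_var v \<in> sym_ideal scale"
  using ring.genideal_self[OF cring.axioms(1)[OF cring_vpoly_ring],
      of "{vpoly_var (v + w) - vpoly_var v - vpoly_var w | v w. True} \<union>
      {vpoly_var (scale c v) - vpoly_const c * vpoly_var v | c v. True}"]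
  by (auto simp: sym_ideal_def)

lemma sym_ideal_least:
  assumes zero: "0 \<in> J" and add: "\<And>p q. \<lbrakk>p \<in> J; q \<in> J\<rbrakk> \<Longrightarrow> p + q \<in> J"
    and mult: "\<And>p q. p \<in> J \<Longrightarrow> q * p \<in> J"
    and gen1: "\<And>v w. vpoly_var (v + w) - vpoly_var v - vpoly_var w \<in> J"
    and gen2: "\<And>c v. vpoly_var (scale c v) - vpoly_const c * vpoly_var v \<in> J"
  shows "sym_ideal scale \<subseteq> J"
  unfolding sym_ideal_def
proof (rule ring.genideal_minimal[OF cring.axioms(1)[OF cring_vpoly_ring]])
  interpret cring "vpoly_ring :: 'a vpoly ring"
    by (rule cring_vpoly_ring)
  have minus: "\<ominus>\<^bsub>vpoly_ring\<^esub> p = - p" for p :: "'a vpoly"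
    by (rule minus_equality) simp_all
  show "ideal J vpoly_ring"
  proof (rule idealI[OF ring_axioms])
    show "subgroup J (add_monoid vpoly_ring)"
      \<comment> \<open>Closure under negation comes from multiplying by the polynomial -1.\<close>
      using zero add mult[of _ "-1"] minus
      by (intro add.subgroupI) (auto simp: a_inv_def)
  qed (use mult in \<open>auto simp: mult.commute\<close>)
qed (use gen1 gen2 in auto)

lemma sym_class_eq_iff: "sym_class scale p = sym_class scale q \<longleftrightarrow> p - q \<in> sym_ideal scale"
proof -
  interpret cring "vpoly_ring :: 'a vpoly ring"
    by (rule cring_vpoly_ring)
  have "\<ominus>\<^bsub>vpoly_ring\<^esub> q = - q"
    by (rule minus_equality) simp_all
  then show ?thesis
    using quotient_eq_iff_same_a_r_cos[OF ideal_sym_ideal[of scale], of p q]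
    by (simp add: a_minus_def)
qed

lemma sym_class_self: "p \<in> sym_class scale p"
proof -
  interpret ideal "sym_ideal scale" vpoly_ring
    by (rule ideal_sym_ideal)
  show ?thesis
    by (rule a_rcos_self) simp
qed

lemma sym_class_mem:
  assumes "q \<in> sym_class scale p"
  shows "sym_class scale q = sym_class scale p"
proof -
  interpret ideal "sym_ideal scale" vpoly_ring
    by (rule ideal_sym_ideal)
  show ?thesis
    using a_repr_independence'[OF assms] by simp
qed

lemma sym_set_add:
  "sym_class scale p <+>\<^bsub>vpoly_ring\<^esub> sym_class scale q = sym_class scale (p + q)"
proof -
  interpret ideal "sym_ideal scale" vpoly_ring
    by (rule ideal_sym_ideal)
  show ?thesis
    using a_rcos_sum[of p q] by simp
qed

lemma sym_algebra_sel:
  "carrier (sym_algebra scale) = range (sym_class scale)"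
  "sym_class scale p \<otimes>\<^bsub>sym_algebra scale\<^esub> sym_class scale q = sym_class scale (p * q)"
  "sym_class scale p \<oplus>\<^bsub>sym_algebra scale\<^esub> sym_class scale q = sym_class scale (p + q)"
  "\<one>\<^bsub>sym_algebra scale\<^esub> = sym_class scale 1"
  "\<zero>\<^bsub>sym_algebra scale\<^esub> = sym_class scale 0"
  "c \<odot>\<^bsub>sym_algebra scale\<^esub> sym_class scale p = sym_class scale (vpoly_const c * p)"
proof -
  interpret ideal "sym_ideal scale" vpoly_ring
    by (rule ideal_sym_ideal)
  show "carrier (sym_algebra scale) = range (sym_class scale)"
    by (auto simp: sym_algebra_def Let_def FactRing_def A_RCOSETS_def RCOSETS_def a_r_coset_def)
  show "\<zero>\<^bsub>sym_algebra scale\<^esub> = sym_class scale 0"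
    using a_rcos_const[OF sym_ideal_closed(1)] by (simp add: sym_algebra_def Let_def FactRing_def)
qed (use ideal.rcoset_mult_add[OF ideal_sym_ideal, of _ _ scale] sym_set_add in
    \<open>simp_all add: sym_algebra_def Let_def FactRing_def\<close>)

lemma sym_algebra_cases:
  assumes "U \<in> carrier (sym_algebra scale)"
  obtains p where "U = sym_class scale p"
  using assms by (auto simp: sym_algebra_sel)

lemma sym_class_carrier: "sym_class scale p \<in> carrier (sym_algebra scale)"
  by (simp add: sym_algebra_sel)

lemma cring_sym_algebra: "cring (sym_algebra scale)"
proof (rule cringI)
  show "abelian_group (sym_algebra scale)"
  proof (rule abelian_groupI)
    fix U assume "U \<in> carrier (sym_algebra scale)"
    then obtain p where "U = sym_class scale p"
      by (rule sym_algebra_cases)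
    then show "\<exists>W\<in>carrier (sym_algebra scale). W \<oplus>\<^bsub>sym_algebra scale\<^esub> U = \<zero>\<^bsub>sym_algebra scale\<^esub>"
      by (intro bexI[of _ "sym_class scale (- p)"]) (simp_all add: sym_algebra_sel)
  qed (auto elim!: sym_algebra_cases simp: sym_class_carrier sym_algebra_sel(2-) ac_simps)
  show "Group.comm_monoid (sym_algebra scale)"
    by (rule comm_monoidI)
      (auto elim!: sym_algebra_cases simp: sym_class_carrier sym_algebra_sel(2-) ac_simps)
qed (auto elim!: sym_algebra_cases simp: sym_algebra_sel(2-) distrib_right)

lemma complex_algebra_sym_algebra: "complex_algebra (sym_algebra scale)"
  by (intro complex_algebra.intro complex_algebra_axioms.intro cring.axioms(1)[OF cring_sym_algebra])
    (auto elim!: sym_algebra_cases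
      simp: sym_class_carrier sym_algebra_sel(2-) vpoly_const_simps distrib_left distrib_right ac_simps)

lemma sym_class_uminus: "\<ominus>\<^bsub>sym_algebra scale\<^esub> sym_class scale p = sym_class scale (- p)"
proof -
  interpret cring "sym_algebra scale"
    by (rule cring_sym_algebra)
  show ?thesis
    by (rule minus_equality) (simp_all add: sym_algebra_sel)
qed

lemma sym_class_mult_cong:
  "\<lbrakk>sym_class scale p = sym_class scale p'; sym_class scale q = sym_class scale q'\<rbrakk> \<Longrightarrow>
    sym_class scale (p * q) = sym_class scale (p' * q')"
  by (metis sym_algebra_sel(2))

lemma sym_class_add_cong:
  "\<lbrakk>sym_class scale p = sym_class scale p'; sym_class scale q = sym_class scale q'\<rbrakk> \<Longrightarrow>
    sym_class scale (p + q) = sym_class scale (p' + q')"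
  by (metis sym_algebra_sel(3))

lemma sym_class_var_add:
  "sym_class scale (vpoly_var (v + w)) = sym_class scale (vpoly_var v + vpoly_var w)"
  using sym_ideal_generators(1)[of v w scale] by (simp add: sym_class_eq_iff diff_diff_eq)

lemma sym_class_var_scale:
  "sym_class scale (vpoly_var (scale c v)) = sym_class scale (vpoly_const c * vpoly_var v)"
  using sym_ideal_generators(2)[of scale c v] by (simp add: sym_class_eq_iff)

text \<open>The universal property of S(V): a linear map into a commutative algebra annihilates both
  kinds of generators, so its multiplicative extension descends to the quotient.\<close>

lemma (in scalar_hom) vpoly_eval_sym_ideal:
  assumes "\<And>v w. \<phi> (v + w) = \<phi> v + \<phi> w" "\<And>c v. \<phi> (scale c v) = \<kappa> c * \<phi> v"
    and "p \<in> sym_ideal scale"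
  shows "vpoly_eval \<kappa> \<phi> p = 0"
proof -
  have "sym_ideal scale \<subseteq> {p. vpoly_eval \<kappa> \<phi> p = 0}"
    by (rule sym_ideal_least) (simp_all add: vpoly_eval_simps assms(1,2))
  then show ?thesis
    using assms(3) by auto
qed

lemma (in scalar_hom) vpoly_eval_class:
  assumes "\<And>v w. \<phi> (v + w) = \<phi> v + \<phi> w" "\<And>c v. \<phi> (scale c v) = \<kappa> c * \<phi> v"
    and "q \<in> sym_class scale p"
  shows "vpoly_eval \<kappa> \<phi> q = vpoly_eval \<kappa> \<phi> p"
proof -
  have "q - p \<in> sym_ideal scale"
    using sym_class_mem[OF assms(3)] by (simp add: sym_class_eq_iff)
  then show ?thesis
    using vpoly_eval_sym_ideal[OF assms(1,2), of "q - p"] by (simp add: vpoly_eval_diff)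
qed

lemma vpoly_rename_simps:
  "vpoly_rename f 0 = 0"
  "vpoly_rename f (vpoly_const c) = vpoly_const c"
  "vpoly_rename f (vpoly_var v) = vpoly_var (f v)"
  "vpoly_rename f (p + q) = vpoly_rename f p + vpoly_rename f q"
  "vpoly_rename f (p - q) = vpoly_rename f p - vpoly_rename f q"
  "vpoly_rename f (p * q) = vpoly_rename f p * vpoly_rename f q"
  "vpoly_rename f 1 = 1"
  "vpoly_rename f (p ^ n) = vpoly_rename f p ^ n"
  by (simp_all add: vpoly_rename_eq const_hom.vpoly_eval_simps)

lemma vpoly_rename_id: "(\<And>v. f v = v) \<Longrightarrow> vpoly_rename f p = p"
  by (induction p rule: vpoly_induct) (simp_all add: vpoly_rename_simps)

lemma vpoly_rename_comp: "vpoly_rename f (vpoly_rename g p) = vpoly_rename (\<lambda>v. f (g v)) p"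
  by (induction p rule: vpoly_induct) (simp_all add: vpoly_rename_simps)

text \<open>\<open>sym_map\<close> is a union over all representatives. Renaming along a linear map
  sends generators of the ideal into the ideal, so every representative contributes the same
  class.\<close>

lemma sym_map_class:
  assumes "Vector_Spaces.linear scale scale f"
  shows "sym_map scale f (sym_class scale p) = sym_class scale (vpoly_rename f p)"
proof -
  interpret f: Vector_Spaces.linear scale scale f
    by fact
  have "sym_ideal scale \<subseteq> {p. vpoly_rename f p \<in> sym_ideal scale}"
    by (rule sym_ideal_least)
      (simp_all add: vpoly_rename_simps f.add f.scale sym_ideal_generators sym_ideal_closed)
  moreover have "q - p \<in> sym_ideal scale" if "q \<in> sym_class scale p" for q
    using sym_class_mem[OF that] by (simp only: sym_class_eq_iff)
  ultimately have "vpoly_rename f (q - p) \<in> sym_ideal scale" if "q \<in> sym_class scale p" for q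
    using that by blast
  then have "sym_class scale (vpoly_rename f q) = sym_class scale (vpoly_rename f p)"
    if "q \<in> sym_class scale p" for q
    using that by (simp only: sym_class_eq_iff vpoly_rename_simps)
  then show ?thesis
    unfolding sym_map_def using sym_class_self[of p scale] by (intro SUP_eq_const) blast+
qed

lemma algebra_action_sym_act:
  fixes G :: "('g, 'm) monoid_scheme"
  assumes "group_action G UNIV \<rho>" "finite (carrier G)"
    and lin: "\<And>g. g \<in> carrier G \<Longrightarrow> Vector_Spaces.linear scale scale (\<rho> g)"
  shows "algebra_action (sym_algebra scale) G (sym_act scale \<rho>)"
proof -
  interpret \<rho>: group_action G UNIV \<rho>
    by fact
  interpret S: complex_algebra "sym_algebra scale"
    by (rule complex_algebra_sym_algebra)
  interpret S: cring "sym_algebra scale"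
    by (rule cring_sym_algebra)
  interpret G: group G
    using \<rho>.group_hom by (simp add: group_hom_def)
  note map = sym_map_class[OF lin]
  show ?thesis
  proof (intro algebra_action.intro algebra_action_axioms.intro S.complex_algebra_axioms S.cring_axioms G.group_axioms)
    fix g h U assume "g \<in> carrier G" "h \<in> carrier G" "U \<in> carrier (sym_algebra scale)"
    moreover from this have "\<rho> (g \<otimes>\<^bsub>G\<^esub> h) = (\<lambda>v. \<rho> g (\<rho> h v))"
      using \<rho>.composition_rule[of _ g h] by auto
    ultimately show "sym_act scale \<rho> (g \<otimes>\<^bsub>G\<^esub> h) U = sym_act scale \<rho> g (sym_act scale \<rho> h U)"
      using map[of "g \<otimes>\<^bsub>G\<^esub> h"] by (auto elim!: sym_algebra_cases simp: map vpoly_rename_comp)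
  next
    fix U assume "U \<in> carrier (sym_algebra scale)"
    moreover have "\<rho> \<one>\<^bsub>G\<^esub> v = v" for v
      using fun_cong[OF \<rho>.id_eq_one, of v] by simp
    ultimately show "sym_act scale \<rho> \<one>\<^bsub>G\<^esub> U = U"
      by (auto elim!: sym_algebra_cases simp: map vpoly_rename_id simp del: \<rho>.id_eq_one)
  qed (auto elim!: sym_algebra_cases
      simp: assms(2) map sym_class_carrier sym_algebra_sel(2-) vpoly_rename_simps)
qed

section \<open>Basis coordinates and derivations of the symmetric algebra\<close>

locale vector_space_basis = vector_space scale
  for scale :: "complex \<Rightarrow> 'v::ab_group_add \<Rightarrow> 'v" +
  fixes B :: "'v set"
  assumes independent_B: "independent B"
    and span_B: "span B = UNIV"
    and finite_B: "finite B"
begin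

abbreviation coord :: "'v \<Rightarrow> 'v \<Rightarrow> complex" where
  "coord v b \<equiv> representation B v b"

text \<open>The canonical representative of a class, in basis variables only; it realises S(V) as
  the polynomial ring over \<open>B\<close>. It is needed because \<open>vpoly_log_deriv\<close>
  does not respect the ideal: a vector \<open>b + w\<close> has a variable of its own, which the
  derivation in \<open>b\<close> does not see.\<close>

definition normal_form :: "'v vpoly \<Rightarrow> 'v vpoly" where
  "normal_form = vpoly_eval vpoly_const (\<lambda>v. \<Sum>b\<in>B. vpoly_const (coord v b) * vpoly_var b)"

lemma coord_add: "coord (v + w) b = coord v b + coord w b"
  using representation_add[OF independent_B, of w v] span_B by (simp add: fun_eq_iff)

lemma coord_scale: "coord (scale c v) b = c * coord v b"
  using representation_scale[OF independent_B, of v c] span_B by (simp add: fun_eq_iff)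

lemma coord_basis: "b \<in> B \<Longrightarrow> coord b b' = (if b = b' then 1 else 0)"
  using representation_basis[OF independent_B, of b] by auto

lemma coord_sum: "(\<Sum>b\<in>B. scale (coord v b) b) = v"
  using sum_representation_eq[OF independent_B _ finite_B subset_refl, of v] span_B by simp

lemma normal_form_simps:
  "normal_form (vpoly_const c) = vpoly_const c"
  "normal_form (vpoly_var v) = (\<Sum>b\<in>B. vpoly_const (coord v b) * vpoly_var b)"
  "normal_form (p + q) = normal_form p + normal_form q"
  "normal_form (p * q) = normal_form p * normal_form q"
  "normal_form (- p) = - normal_form p"
  "normal_form (p ^ n) = normal_form p ^ n"
  by (simp_all add: normal_form_def const_hom.vpoly_eval_simps)

lemma normal_form_class: "q \<in> sym_class scale p \<Longrightarrow> normal_form q = normal_form p"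
  unfolding normal_form_def
  by (rule const_hom.vpoly_eval_class)
    (simp_all add: coord_add coord_scale vpoly_const_simps distrib_right sum.distrib
      sum_distrib_left mult.assoc)

lemma normal_form_basis:
  assumes "b \<in> B"
  shows "normal_form (vpoly_var b) = vpoly_var b"
proof -
  have "normal_form (vpoly_var b) = (\<Sum>c\<in>B. if b = c then vpoly_var c else 0)"
    unfolding normal_form_simps
    by (rule sum.cong) (simp_all add: coord_basis[OF assms] vpoly_const_simps)
  then show ?thesis
    using assms finite_B by simp
qed

lemma sym_class_normal_form: "sym_class scale (normal_form p) = sym_class scale p"
proof (induction p rule: vpoly_induct)
  case (var v)
  \<comment> \<open>Stated for arbitrary finite sets and coefficients, so that the linear relations
    can be applied one summand at a time.\<close>
  have "sym_class scale (vpoly_var (\<Sum>b\<in>F. scale (r b) b)) =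
      sym_class scale (\<Sum>b\<in>F. vpoly_const (r b) * vpoly_var b)" if "finite F" for F r
    using that
  proof (induction F)
    case empty
    \<comment> \<open>The variable of the zero vector is not the zero polynomial; it is congruent to
      it by the scaling relation with scalar 0.\<close>
    show ?case
      using sym_class_var_scale[of scale 0 0] by (simp add: vpoly_const_simps)
  next
    case (insert b F)
    have "sym_class scale (vpoly_var (scale (r b) b + (\<Sum>b\<in>F. scale (r b) b))) =
        sym_class scale (vpoly_const (r b) * vpoly_var b + (\<Sum>b\<in>F. vpoly_const (r b) * vpoly_var b))"
      by (rule trans[OF sym_class_var_add sym_class_add_cong[OF sym_class_var_scale insert.IH]])
    then show ?case
      using insert.hyps by simp
  qed
  from this[OF finite_B, of "coord v"] show ?case
    by (simp add: coord_sum normal_form_simps)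
next
  case (add p q)
  then show ?case
    unfolding normal_form_simps by (rule sym_class_add_cong)
next
  case (mult p q)
  then show ?case
    unfolding normal_form_simps by (rule sym_class_mult_cong)
qed (simp add: normal_form_simps)

definition log_deriv :: "'v \<Rightarrow> 'v vpoly set \<Rightarrow> 'v vpoly set" where
  "log_deriv b U = (\<Union>p\<in>U. sym_class scale (vpoly_log_deriv b (normal_form p)))"

lemma log_deriv_class:
  "log_deriv b (sym_class scale p) = sym_class scale (vpoly_log_deriv b (normal_form p))"
proof -
  have "sym_class scale (vpoly_log_deriv b (normal_form q)) =
      sym_class scale (vpoly_log_deriv b (normal_form p))" if "q \<in> sym_class scale p" for q
    using normal_form_class[OF that] by simp
  then show ?thesis
    unfolding log_deriv_def using sym_class_self[of p scale] by (intro SUP_eq_const) blast+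
qed

lemma derivation_log_deriv: "derivation (sym_algebra scale) (log_deriv b)"
proof -
  \<comment> \<open>The Leibniz rule leaves normal forms as undifferentiated factors; modulo the
    ideal they may be exchanged for the given representatives.\<close>
  have "sym_class scale (vpoly_log_deriv b (normal_form p * normal_form q)) =
      sym_class scale (p * vpoly_log_deriv b (normal_form q) + vpoly_log_deriv b (normal_form p) * q)" for p q
    unfolding vpoly_log_deriv_mult
    by (intro sym_class_add_cong sym_class_mult_cong sym_class_normal_form refl)
  then show ?thesis
    unfolding derivation_def
    by (intro conjI ballI allI Pi_I)
      (elim sym_algebra_cases, simp only: sym_class_carrier log_deriv_class sym_algebra_sel(2-)
        normal_form_simps vpoly_log_deriv_add vpoly_log_deriv_mult vpoly_log_deriv_const
        mult_zero_left add_0_right)+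
qed

lemma vpoly_log_deriv_normal_form_var:
  assumes "b \<in> B"
  shows "vpoly_log_deriv b (normal_form (vpoly_var v)) = vpoly_const (coord v b) * vpoly_var b"
proof -
  have "vpoly_log_deriv b (normal_form (vpoly_var v)) =
      (\<Sum>c\<in>B. if c = b then vpoly_const (coord v c) * vpoly_var c else 0)"
    unfolding normal_form_simps vpoly_log_deriv_sum
    by (rule sum.cong) (simp_all add: vpoly_log_deriv_mult vpoly_log_deriv_const vpoly_log_deriv_var)
  then show ?thesis
    using assms finite_B by simp
qed

text \<open>A diagonal map and this derivation both act by scalars on monomials in the basis, hence
  they commute. The proof checks generators modulo the ideal, since the variable of
  \<open>scale (\<chi> b) b\<close> is only congruent to a multiple of that of
  \<open>b\<close>.\<close>

lemma log_deriv_sym_map: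
  assumes f: "Vector_Spaces.linear scale scale f" and b: "b \<in> B"
    and diag: "\<And>b. b \<in> B \<Longrightarrow> f b = scale (\<chi> b) b"
    and U: "U \<in> carrier (sym_algebra scale)"
  shows "log_deriv b (sym_map scale f U) = sym_map scale f (log_deriv b U)"
proof -
  interpret f: Vector_Spaces.linear scale scale f
    by fact
  obtain p where p: "U = sym_class scale p"
    using U by (rule sym_algebra_cases)
  have f_class: "sym_class scale (vpoly_rename f (normal_form q)) = sym_class scale (vpoly_rename f q)" for q
    using sym_map_class[OF f] sym_class_normal_form by metis
  have "sym_class scale (vpoly_log_deriv b (normal_form (vpoly_rename f p))) =
      sym_class scale (vpoly_rename f (vpoly_log_deriv b (normal_form p)))"
  proof (induction p rule: vpoly_induct)
    case (const c)
    show ?case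
      by (simp add: vpoly_rename_simps normal_form_simps vpoly_log_deriv_const)
  next
    case (var v)
    \<comment> \<open>On a variable both sides reduce to this coordinate times the variable of
      \<open>b\<close>.\<close>
    have "coord (f v) b = \<chi> b * coord v b"
    proof -
      have "f v = f (\<Sum>c\<in>B. scale (coord v c) c)"
        by (simp add: coord_sum)
      also have "\<dots> = (\<Sum>c\<in>B. scale (coord v c * \<chi> c) c)"
        unfolding f.sum by (rule sum.cong) (simp_all add: f.scale diag)
      finally have "f v = (\<Sum>c\<in>B. scale (coord v c * \<chi> c) c)" .
      moreover have "coord (\<Sum>c\<in>C. scale (r c) c) b = (\<Sum>c\<in>C. r c * coord c b)" for r C
        by (induction C rule: infinite_finite_induct)
          (simp_all add: coord_add coord_scale representation_zero)
      ultimately have "coord (f v) b = (\<Sum>c\<in>B. coord v c * \<chi> c * coord c b)"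
        by simp
      also have "\<dots> = (\<Sum>c\<in>B. if c = b then coord v c * \<chi> c else 0)"
        by (rule sum.cong) (simp_all add: coord_basis)
      finally show ?thesis
        using b finite_B by simp
    qed
    then show ?case
      using sym_class_mult_cong[OF refl sym_class_var_scale, of scale "vpoly_const (coord v b)" "\<chi> b" b]
      by (simp add: vpoly_rename_simps vpoly_log_deriv_normal_form_var[OF b] diag[OF b]
          vpoly_const_simps ac_simps)
  next
    case (add p q)
    then show ?case
      unfolding vpoly_rename_simps normal_form_simps vpoly_log_deriv_add by (rule sym_class_add_cong)
  next
    case (mult p q)
    show ?case
      unfolding vpoly_rename_simps normal_form_simps vpoly_log_deriv_mult
      by (intro sym_class_add_cong sym_class_mult_cong mult.IH)
        (simp_all add: sym_class_normal_form f_class)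
  qed
  then show ?thesis
    by (simp add: p log_deriv_class sym_map_class[OF f])
qed

end

section \<open>Simultaneous diagonalization\<close>

lemma sum_roots_unity:
  assumes "0 < n" "j < n"
  shows "(\<Sum>k<n. cis (2 * pi * real k / real n) ^ j) = (if j = 0 then of_nat n else 0)"
proof -
  let ?z = "cis (2 * pi * real j / real n)"
  have "cis (2 * pi * real k / real n) ^ j = ?z ^ k" for k
    by (simp add: DeMoivre ac_simps)
  moreover have "(\<Sum>k<n. ?z ^ k) = 0" if "j \<noteq> 0"
  proof -
    \<comment> \<open>The number 1 is written as the root with index 0, so that injectivity of the
      enumeration of roots of unity separates it from the root with index \<open>j\<close>.\<close>
    have "?z \<noteq> cis (2 * pi * real 0 / real n)"
      using bij_betw_imp_inj_on[OF bij_betw_roots_unity[OF assms(1)]] assms that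
      by (subst inj_on_eq_iff) auto
    moreover have "?z ^ n = 1"
      using bij_betwE[OF bij_betw_roots_unity[OF assms(1)]] assms by auto
    ultimately show ?thesis
      by (simp add: geometric_sum)
  qed
  ultimately show ?thesis
    by simp
qed

text \<open>The zero vector belongs to this set, which is in general not a subspace; only its span
  and independent subsets matter.\<close>

definition common_eigenvectors :: "('k \<Rightarrow> 'v \<Rightarrow> 'v) \<Rightarrow> ('v \<Rightarrow> 'v) set \<Rightarrow> 'v set" where
  "common_eigenvectors scale F = {v. \<forall>T\<in>F. \<exists>c. T v = scale c v}"

text \<open>The Fourier components of \<open>v\<close> under the cyclic group generated by \<open>T\<close> are eigenvectors of
  \<open>T\<close>, and they remain eigenvectors of every operator commuting with \<open>T\<close>.\<close>

lemma common_eigenvectors_span_insert: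
  fixes scale :: "complex \<Rightarrow> 'v::ab_group_add \<Rightarrow> 'v"
  assumes T: "Vector_Spaces.linear scale scale T" "0 < n" "\<And>v. (T ^^ n) v = v"
    and F: "\<And>U. U \<in> F \<Longrightarrow> Vector_Spaces.linear scale scale U" "\<And>U v. U \<in> F \<Longrightarrow> U (T v) = T (U v)"
    and v: "v \<in> common_eigenvectors scale F"
  shows "v \<in> module.span scale (common_eigenvectors scale (insert T F))"
proof -
  interpret vector_space scale
    using T(1) by (rule Vector_Spaces.linear.axioms(1))
  interpret T: Vector_Spaces.linear scale scale T
    by fact
  define z where "z k = cis (2 * pi * real k / real n)" for k
  \<comment> \<open>Up to the factor n this is the projection of \<open>v\<close> to the eigenspace
    of \<open>T\<close> for the inverse of \<open>z k\<close>.\<close>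
  define p where "p k = (\<Sum>j<n. scale (z k ^ j) ((T ^^ j) v))" for k
  have z: "z k ^ n = 1" "z k \<noteq> 0" if "k < n" for k
    using bij_betwE[OF bij_betw_roots_unity[OF T(2)]] that by (auto simp: z_def)
  have T_p: "T (p k) = scale (inverse (z k)) (p k)" if "k < n" for k
  proof -
    let ?f = "\<lambda>j. scale (z k ^ j) ((T ^^ j) v)"
    \<comment> \<open>A cyclic shift: the terms with index n and 0 agree because both the root and
      \<open>T\<close> have n-th power one.\<close>
    have "(\<Sum>j<n. ?f (Suc j)) = (\<Sum>j<n. ?f j)"
      using sum.lessThan_Suc_shift[of ?f n] z[OF that] T(3)[of v] by (simp add: add.commute)
    moreover have "scale (z k) (T (p k)) = (\<Sum>j<n. ?f (Suc j))"
      by (simp add: p_def T.sum T.scale scale_sum_right)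
    ultimately have "scale (z k) (T (p k)) = p k"
      by (simp add: p_def)
    then have "scale (inverse (z k)) (scale (z k) (T (p k))) = scale (inverse (z k)) (p k)"
      by simp
    then show ?thesis
      using z[OF that] by simp
  qed
  have U_p: "\<exists>c. U (p k) = scale c (p k)" if U: "U \<in> F" for U k
  proof -
    interpret U: Vector_Spaces.linear scale scale U
      by (rule F(1)[OF U])
    obtain c where c: "U v = scale c v"
      using v U by (auto simp: common_eigenvectors_def)
    have "U ((T ^^ j) v) = scale c ((T ^^ j) v)" for j
      by (induction j) (simp_all add: c F(2)[OF U] T.scale)
    then have "U (p k) = scale c (p k)"
      by (simp add: p_def U.sum U.scale scale_sum_right mult.commute)
    then show ?thesis
      by blast
  qed
  have p: "p k \<in> common_eigenvectors scale (insert T F)" if "k < n" for k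
    using T_p[OF that] U_p by (auto simp: common_eigenvectors_def)
  \<comment> \<open>Fourier inversion: orthogonality of the roots of unity leaves only the term with
    j = 0.\<close>
  have "(\<Sum>k<n. p k) = (\<Sum>j<n. scale (\<Sum>k<n. z k ^ j) ((T ^^ j) v))"
    unfolding p_def by (subst sum.swap) (simp add: scale_sum_left)
  also have "\<dots> = (\<Sum>j<n. if j = 0 then scale (of_nat n) v else 0)"
    by (rule sum.cong) (simp_all add: z_def sum_roots_unity[OF T(2)])
  also have "\<dots> = scale (of_nat n) v"
    using T(2) by simp
  finally have "scale (1 / of_nat n) (\<Sum>k<n. p k) = v"
    using T(2) by simp
  moreover have "scale (1 / of_nat n) (\<Sum>k<n. p k) \<in> span (common_eigenvectors scale (insert T F))"
    using p by (intro span_scale span_sum span_base) auto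
  ultimately show ?thesis
    by simp
qed

lemma common_eigenvectors_span:
  fixes scale :: "complex \<Rightarrow> 'v::ab_group_add \<Rightarrow> 'v"
  assumes "vector_space scale" "finite F" "0 < n"
    and "\<And>T. T \<in> F \<Longrightarrow> Vector_Spaces.linear scale scale T"
    and "\<And>T v. T \<in> F \<Longrightarrow> (T ^^ n) v = v"
    and "\<And>T U v. \<lbrakk>T \<in> F; U \<in> F\<rbrakk> \<Longrightarrow> U (T v) = T (U v)"
  shows "module.span scale (common_eigenvectors scale F) = UNIV"
proof -
  interpret vector_space scale
    by fact
  show ?thesis
    using assms(2,4-6)
  proof (induction F)
    case empty
    show ?case
      by (simp add: common_eigenvectors_def)
  next
    case (insert T F)
    have "common_eigenvectors scale F \<subseteq> span (common_eigenvectors scale (insert T F))"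
    proof
      fix v assume "v \<in> common_eigenvectors scale F"
      then show "v \<in> span (common_eigenvectors scale (insert T F))"
        by (rule common_eigenvectors_span_insert[OF _ assms(3), rotated -1]) (use insert.prems in auto)
    qed
    then have "span (common_eigenvectors scale F) \<subseteq> span (common_eigenvectors scale (insert T F))"
      by (simp add: span_minimal subspace_span)
    then show ?case
      using insert by auto
  qed
qed

lemma obtain_eigenbasis:
  fixes scale :: "complex \<Rightarrow> 'v::ab_group_add \<Rightarrow> 'v"
  assumes "comm_group G" "finite (carrier G)"
    and "finite_dimensional_vector_space scale Basis"
    and "group_action G UNIV \<rho>"
    and lin: "\<And>g. g \<in> carrier G \<Longrightarrow> Vector_Spaces.linear scale scale (\<rho> g)"
  obtains B where "vector_space_basis scale B" "card B = vector_space.dim scale (UNIV :: 'v set)"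
    "B \<subseteq> common_eigenvectors scale (\<rho> ` carrier G)"
proof -
  interpret finite_dimensional_vector_space scale Basis
    by fact
  interpret G: comm_group G
    by fact
  interpret \<rho>: group_action G UNIV \<rho>
    by fact
  have comp: "\<rho> (g \<otimes>\<^bsub>G\<^esub> h) v = \<rho> g (\<rho> h v)" if "g \<in> carrier G" "h \<in> carrier G" for g h v
    using \<rho>.composition_rule[OF _ that] by simp
  have one: "\<rho> \<one>\<^bsub>G\<^esub> v = v" for v
    using fun_cong[OF \<rho>.id_eq_one, of v] by simp
  have pow: "(\<rho> g ^^ k) v = \<rho> (g [^]\<^bsub>G\<^esub> k) v" if "g \<in> carrier G" for g k v
    using that by (induction k) (simp_all add: one comp[symmetric] G.m_comm)
  have "span (common_eigenvectors scale (\<rho> ` carrier G)) = UNIV"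
  proof (rule common_eigenvectors_span)
    show "0 < order G"
      using assms(2) by (simp add: G.order_gt_0_iff_finite)
    show "(T ^^ order G) v = v" if "T \<in> \<rho> ` carrier G" for T v
      using that by (auto simp: pow G.pow_order_eq_1 one)
    show "U (T v) = T (U v)" if "T \<in> \<rho> ` carrier G" "U \<in> \<rho> ` carrier G" for T U v
      using that by (auto simp: comp[symmetric] G.m_comm)
  qed (use assms(2) lin in \<open>auto intro: vector_space_axioms\<close>)
  \<comment> \<open>A maximal independent subset of a spanning set is a basis, so this one consists
    of eigenvectors.\<close>
  moreover obtain B where B: "B \<subseteq> common_eigenvectors scale (\<rho> ` carrier G)" "independent B"
    "common_eigenvectors scale (\<rho> ` carrier G) \<subseteq> span B"
    using maximal_independent_subset by blast
  ultimately have span_B: "span B = UNIV"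
    using span_minimal[OF B(3) subspace_span] by auto
  show thesis
  proof
    show "vector_space_basis scale B"
      using B(2) span_B finiteI_independent[OF B(2)] by unfold_locales
    show "card B = dim (UNIV :: 'v set)"
      using dim_eq_card[of B UNIV] B(2) span_B by simp
  qed (rule B(1))
qed

section \<open>The bivector field with nonzero square bracket\<close>

text \<open>Commutativity lets \<open>u\<close> pass the undifferentiated factor, so a multiple of a
  derivation is a derivation.\<close>

lemma (in complex_algebra) derivation_diff_mult:
  assumes "cring A" "derivation A D" "derivation A E" "u \<in> carrier A"
  shows "derivation A (\<lambda>x. D x \<ominus> u \<otimes> E x)"
proof -
  interpret cring A
    by fact
  note [simp] = derivationD[OF assms(2)] derivationD[OF assms(3)] assms(4)
  have "x \<otimes> D y \<oplus> D x \<otimes> y \<ominus> u \<otimes> (x \<otimes> E y \<oplus> E x \<otimes> y) =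
      x \<otimes> (D y \<ominus> u \<otimes> E y) \<oplus> (D x \<ominus> u \<otimes> E x) \<otimes> y"
    if "x \<in> carrier A" "y \<in> carrier A" for x y
  proof -
    have "D x \<in> carrier A" "D y \<in> carrier A" "E x \<in> carrier A" "E y \<in> carrier A"
      using that by simp_all
    then show ?thesis
      using that assms(4) by algebra
  qed
  moreover have "D x \<oplus> D y \<ominus> u \<otimes> (E x \<oplus> E y) = D x \<ominus> u \<otimes> E x \<oplus> (D y \<ominus> u \<otimes> E y)"
    if "x \<in> carrier A" "y \<in> carrier A" for x y
    using that by (simp add: r_distr minus_eq minus_add a_ac)
  ultimately show ?thesis
    by (simp add: derivation_def minus_eq smult_r_distr smult_minus smult_mult_r)
qed

lemma (in algebra_action) act_uminus:
  "\<lbrakk>g \<in> carrier G; x \<in> carrier S\<rbrakk> \<Longrightarrow> act g (\<ominus> x) = \<ominus> act g x"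
  using act_smult[of g x "-1"] act_closed[of g x] by simp

lemma (in algebra_action) equivariant_diff_mult:
  assumes "derivation S D" "derivation S E" "u \<in> carrier S"
    and "\<And>x. x \<in> carrier S \<Longrightarrow> D (act g x) = act g (D x)"
    and "\<And>x. x \<in> carrier S \<Longrightarrow> E (act g x) = act g (E x)"
    and "act g u = u" "g \<in> carrier G" "x \<in> carrier S"
  shows "D (act g x) \<ominus> u \<otimes> E (act g x) = act g (D x \<ominus> u \<otimes> E x)"
  using assms by (simp add: derivationD(1) minus_eq act_add act_mult act_uminus)

theorem theorem10p2:
  fixes G :: "('g, 'm) monoid_scheme"
    and scale :: "complex \<Rightarrow> 'v::ab_group_add \<Rightarrow> 'v"
    and Basis :: "'v set"
    and \<rho> :: "'g \<Rightarrow> 'v \<Rightarrow> 'v"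
  assumes "comm_group G" and "finite (carrier G)"
    and "finite_dimensional_vector_space scale Basis"
    and "group_action G UNIV \<rho>"
    and "\<And>g. g \<in> carrier G \<Longrightarrow> Vector_Spaces.linear scale scale (\<rho> g)"
    and "vector_space.dim scale (UNIV :: 'v set) \<ge> 3"
  shows "(\<exists>\<alpha>\<in>carrier (HH_alg (sym_skew G scale \<rho>) 2).
            HH_supported_on G (sym_algebra scale) (sym_act scale \<rho>) 2 (action_kernel G \<rho>) \<alpha> \<and>
            HH_bracket (sym_skew G scale \<rho>) 2 2 \<alpha> \<alpha> \<noteq> \<one>\<^bsub>HH_alg (sym_skew G scale \<rho>) 3\<^esub>) \<and>
         (\<exists>\<alpha>\<in>carrier (HH_alg (sym_skew G scale \<rho>) 2).
            HH_supported_on G (sym_algebra scale) (sym_act scale \<rho>) 2 (action_kernel G \<rho>) \<alpha> \<and>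
            HH_bracket (sym_skew G scale \<rho>) 2 2 \<alpha> \<alpha> = \<one>\<^bsub>HH_alg (sym_skew G scale \<rho>) 3\<^esub>)"
proof -
  obtain B where "vector_space_basis scale B"
    and card_B: "card B = vector_space.dim scale (UNIV :: 'v set)"
    and eigen: "B \<subseteq> common_eigenvectors scale (\<rho> ` carrier G)"
    using obtain_eigenbasis[OF assms(1-5)] .
  interpret vector_space_basis scale B
    by fact
  interpret algebra_action "sym_algebra scale" G "sym_act scale \<rho>"
    by (rule algebra_action_sym_act[OF assms(4,2,5)])
  interpret \<rho>: group_action G UNIV \<rho>
    by (rule assms(4))
  let ?S = "sym_algebra scale"
  let ?cls = "sym_class scale"
  let ?n = "order G"

  have "\<exists>c. \<rho> g b = scale c b" if "g \<in> carrier G" "b \<in> B" for g b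
    using eigen that by (auto simp: common_eigenvectors_def)
  then obtain \<chi> where chi: "\<rho> g b = scale (\<chi> g b) b" if "g \<in> carrier G" "b \<in> B" for g b
    by metis
  obtain b1 b2 b3 where b: "b1 \<in> B" "b2 \<in> B" "b3 \<in> B" and b_neq: "b1 \<noteq> b2" "b1 \<noteq> b3" "b2 \<noteq> b3"
  proof -
    obtain C where "C \<subseteq> B" "card C = 3"
      using assms(6) card_B by (metis obtain_subset_with_card_n)
    then show thesis
      using that by (auto simp: card_3_iff)
  qed
  have n_pos: "0 < ?n"
    using assms(2) by (simp add: grp.order_gt_0_iff_finite)

  define x where "x b = ?cls (vpoly_var b)" for b
  define u where "u = ?cls (vpoly_var b2 ^ ?n)"
  define D where "D = log_deriv b2"
  define E where "E U = log_deriv b1 U \<ominus>\<^bsub>?S\<^esub> u \<otimes>\<^bsub>?S\<^esub> log_deriv b3 U" for U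
  have u: "u \<in> carrier ?S"
    by (simp add: u_def sym_class_carrier)

  \<comment> \<open>The power of g to the group order is the identity, so it fixes
    \<open>b2\<close>; as a basis vector \<open>b2\<close> is nonzero and can be cancelled.\<close>
  have chi_power: "\<chi> g b2 ^ ?n = 1" if g: "g \<in> carrier G" for g
  proof -
    have "\<rho> (g [^]\<^bsub>G\<^esub> k) b2 = scale (\<chi> g b2 ^ k) b2" for k
    proof (induction k)
      case 0
      show ?case
        using fun_cong[OF \<rho>.id_eq_one, of b2] by simp
    next
      case (Suc k)
      interpret g: Vector_Spaces.linear scale scale "\<rho> (g [^]\<^bsub>G\<^esub> k)"
        using assms(5) g by simp
      show ?case
        using \<rho>.composition_rule[of b2 "g [^]\<^bsub>G\<^esub> k" g] g
        by (simp add: chi[OF g b(2)] g.scale Suc)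
    qed
    from this[of ?n] have "scale (\<chi> g b2 ^ ?n) b2 = scale 1 b2"
      using g fun_cong[OF \<rho>.id_eq_one, of b2] by (simp add: grp.pow_order_eq_1)
    moreover have "b2 \<noteq> 0"
      using b(2) independent_B dependent_zero by blast
    ultimately show ?thesis
      by (simp only: scale_cancel_right simp_thms)
  qed
  have u_inv: "sym_act scale \<rho> g u = u" if g: "g \<in> carrier G" for g
  proof -
    \<comment> \<open>The action renames the variable of \<open>b2\<close> to that of a multiple of
      \<open>b2\<close>, and the scalar can be taken out only modulo the ideal.\<close>
    have "?cls (vpoly_var (scale c v) ^ k) = ?cls ((vpoly_const c * vpoly_var v) ^ k)" for c v k
      by (induction k) (simp_all add: sym_class_mult_cong[OF sym_class_var_scale])
    then show ?thesis
      using chi_power[OF g]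
      by (simp add: u_def sym_map_class[OF assms(5)[OF g]] vpoly_rename_simps chi[OF g b(2)]
          power_mult_distrib vpoly_const_power[symmetric] vpoly_const_simps)
  qed
  have log_equiv: "log_deriv b (sym_act scale \<rho> g U) = sym_act scale \<rho> g (log_deriv b U)"
    if "b \<in> B" "g \<in> carrier G" "U \<in> carrier ?S" for b g U
    using log_deriv_sym_map[OF assms(5) that(1) chi that(3)] that(2) by blast
  note der = derivation_log_deriv
  have D: "derivation ?S D" and E: "derivation ?S E"
    unfolding D_def E_def using derivation_diff_mult[OF cring_axioms der der u] der by auto
  have D_equiv: "D (sym_act scale \<rho> g U) = sym_act scale \<rho> g (D U)"
    and E_equiv: "E (sym_act scale \<rho> g U) = sym_act scale \<rho> g (E U)"
    if "g \<in> carrier G" "U \<in> carrier ?S" for g U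
    using that log_equiv b equivariant_diff_mult[OF der der u _ _ u_inv]
    by (simp_all add: D_def E_def)

  define f where "f = cup_product A (lift E) (lift D)"
  have f: "f \<in> cocycles A (carrier A) (carrier A) 2"
    unfolding f_def
    by (intro skew.cup_product_cocycle derivation_lift D E D_equiv E_equiv)
  then have f_cochain: "f \<in> cochains A (carrier A) (carrier A) 2"
    by (simp add: cocycles_def)
  have f_S1: "f [a, b] \<in> S1" if "a \<in> S1" "b \<in> S1" for a b
  proof -
    interpret S1: hochschild A S1 S1
      by (rule hochschild_component) simp
    show ?thesis
      using that S1.B_carrier S1.B_mult lift_component D E
      by (simp add: f_def skew.cup_product_apply)
  qed
  have K: "action_kernel G \<rho> \<subseteq> carrier G" "\<one>\<^bsub>G\<^esub> \<in> action_kernel G \<rho>"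
    using fun_cong[OF \<rho>.id_eq_one] by (auto simp: action_kernel_def invariants_def)

  \<comment> \<open>The linear functional that is 1 on every basis vector; \<open>T\<close> is
    evaluation at the corresponding point. The choice of a representative in \<open>T\<close> is
    harmless, since evaluation is constant on classes.\<close>
  define \<phi> where "\<phi> v = (\<Sum>b\<in>B. coord v b)" for v
  define T where "T U = vpoly_eval (\<lambda>c. c) \<phi> (SOME p. p \<in> U)" for U
  have T_cls: "T (?cls p) = vpoly_eval (\<lambda>c. c) \<phi> p" for p
    unfolding T_def
  proof (rule id_hom.vpoly_eval_class)
    show "(SOME q. q \<in> ?cls p) \<in> ?cls p"
      by (rule someI[where P = "\<lambda>q. q \<in> ?cls p", OF sym_class_self])
  qed (simp_all add: \<phi>_def coord_add coord_scale sum.distrib sum_distrib_left)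
  have phi: "\<phi> b = 1" if "b \<in> B" for b
    using that finite_B by (simp add: \<phi>_def coord_basis)
  have log_deriv_x: "log_deriv b (x b') = ?cls (if b' = b then vpoly_var b' else 0)" if "b' \<in> B" for b b'
    using that by (simp add: x_def log_deriv_class normal_form_basis vpoly_log_deriv_var)
  note cls = sym_algebra_sel(2,3) sym_class_uminus a_minus_def
  have E_x: "E (x b1) = ?cls (vpoly_var b1)" "E (x b2) = \<zero>\<^bsub>?S\<^esub>"
      "E (x b3) = ?cls (- (vpoly_var b2 ^ ?n * vpoly_var b3))"
    and D_x: "D (x b1) = \<zero>\<^bsub>?S\<^esub>" "D (x b2) = ?cls (vpoly_var b2)" "D (x b3) = \<zero>\<^bsub>?S\<^esub>"
    using b b_neq by (simp_all add: E_def D_def u_def log_deriv_x cls sym_algebra_sel(5))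
  have D_cls: "D (?cls p) = ?cls (vpoly_log_deriv b2 (normal_form p))" for p
    by (simp add: D_def log_deriv_class)

  have "gerstenhaber_bracket A 2 2 f f \<notin> coboundaries A (carrier A) (carrier A) 3"
    unfolding f_def
  proof (rule square_bracket_nonzero[OF E E_equiv D D_equiv, of "x b1" "x b2" "x b3" T])
    show "x b1 \<in> carrier ?S" "x b2 \<in> carrier ?S" "x b3 \<in> carrier ?S"
      by (simp_all add: x_def sym_class_carrier)
    show "T (U \<oplus>\<^bsub>?S\<^esub> W) = T U + T W" if "U \<in> carrier ?S" "W \<in> carrier ?S" for U W
      using that by (auto elim!: sym_algebra_cases simp: cls T_cls id_hom.vpoly_eval_simps)
    \<comment> \<open>Here \<open>D\<close> acts on -x_2^(n+1) x_3, which it multiplies by n + 1; at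
      the point with all coordinates 1 this leaves -(n + 1).\<close>
    have "T (E (x b1) \<otimes>\<^bsub>?S\<^esub> D (E (x b3) \<otimes>\<^bsub>?S\<^esub> D (x b2))) = - of_nat ?n - 1"
      using b b_neq
      by (simp add: E_x D_x D_cls cls normal_form_simps(3-) normal_form_basis
          vpoly_log_deriv_mult vpoly_log_deriv_uminus vpoly_log_deriv_power vpoly_log_deriv_var
          T_cls id_hom.vpoly_eval_simps phi)
    \<comment> \<open>Now x_2^n stands outside \<open>D\<close>, which sees only x_1 x_2 and
      multiplies it by 1. The two values differ by n, the contribution of D_2(u).\<close>
    moreover have "T (E (x b3) \<otimes>\<^bsub>?S\<^esub> D (E (x b1) \<otimes>\<^bsub>?S\<^esub> D (x b2))) = - 1"
      using b b_neq
      by (simp add: E_x D_x D_cls cls normal_form_simps(3-) normal_form_basis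
          vpoly_log_deriv_mult vpoly_log_deriv_var T_cls id_hom.vpoly_eval_simps phi)
    ultimately show "T (E (x b1) \<otimes>\<^bsub>?S\<^esub> D (E (x b3) \<otimes>\<^bsub>?S\<^esub> D (x b2))) \<noteq>
        T (E (x b3) \<otimes>\<^bsub>?S\<^esub> D (E (x b1) \<otimes>\<^bsub>?S\<^esub> D (x b2)))"
      using n_pos by simp
  qed (rule E_x D_x | assumption)+
  moreover have "f \<in> HH_class A (carrier A) (carrier A) 2 f"
    by (rule skew.self.HH_class_self[OF cochains_PiE[OF f_cochain]])
  moreover have "gerstenhaber_bracket A 2 2 f f \<in>
      HH_class A (carrier A) (carrier A) 3 (gerstenhaber_bracket A 2 2 f f)"
    by (rule skew.self.HH_class_self[OF skew.gerstenhaber_bracket_2_2_closed[OF f_cochain f_cochain]])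
  \<comment> \<open>The bracket of classes is a union that contains the bracket of \<open>f\<close>
    with itself; this element alone keeps the union from being the set of coboundaries.\<close>
  ultimately have bracket: "HH_bracket A 2 2 (HH_class A (carrier A) (carrier A) 2 f)
      (HH_class A (carrier A) (carrier A) 2 f) \<noteq> \<one>\<^bsub>HH_alg A 3\<^esub>"
    by (auto simp: HH_bracket_def skew.self.one_HH)

  let ?zero = "zero_cochain A (carrier A) 2"
  have zero_class: "HH_class A (carrier A) (carrier A) 2 ?zero = \<one>\<^bsub>HH_alg A 2\<^esub>"
    by (simp add: skew.self.one_HH skew.self.HH_class_coboundary skew.self.coboundaries_zero)
  have zero_supported: "HH_supported_on G ?S (sym_act scale \<rho>) 2 (action_kernel G \<rho>)
      (HH_class A (carrier A) (carrier A) 2 ?zero)"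
  proof (rule supported_onI[OF skew.self.zero_cocycle _ K])
    interpret S1: hochschild A S1 S1
      by (rule hochschild_component) simp
    show "?zero [a, b] \<in> S1" if "a \<in> S1" "b \<in> S1" for a b
      using that S1.B_carrier S1.M_zero by (simp add: zero_cochain_def tuples_def)
  qed
  show ?thesis
  proof
    show "\<exists>\<alpha>\<in>carrier (HH_alg A 2). HH_supported_on G ?S (sym_act scale \<rho>) 2 (action_kernel G \<rho>) \<alpha> \<and>
        HH_bracket A 2 2 \<alpha> \<alpha> \<noteq> \<one>\<^bsub>HH_alg A 3\<^esub>"
      using skew.self.HH_class_closed[OF f] supported_onI[OF f f_S1 K] bracket by blast
    show "\<exists>\<alpha>\<in>carrier (HH_alg A 2). HH_supported_on G ?S (sym_act scale \<rho>) 2 (action_kernel G \<rho>) \<alpha> \<and>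
        HH_bracket A 2 2 \<alpha> \<alpha> = \<one>\<^bsub>HH_alg A 3\<^esub>"
      using skew.self.HH_class_closed[OF skew.self.zero_cocycle, of 2] zero_supported skew.HH_bracket_one
      unfolding zero_class by blast
  qed
qed

end
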